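(* Let $p,n\in\mathbb N$ with $p\ge n\ge 10$, and write $p=k(n-1)+r$ with $k\in\mathbb N$ and $r\in\{0,1,\ldots,n-2\}$. Then $$\mathrm{ex}(p;T_n''')=\frac{(n-2)p-r(n-1-r)}2+\max\Big\{0,\Big\lfloor\frac{r(n-4-r)-3(n-1)}2\Big\rfloor\Big\}.$$
   Context: All graphs are finite simple graphs. For a graph $L$, $\mathrm{ex}(p;L)$ denotes the maximum number of edges in a graph on $p$ vertices that contains no subgraph isomorphic to $L$. For $n\ge 6$, $T_n'''$ is the tree on vertex set $\{v_0,\ldots,v_{n-1}\}$ with edge set $\{v_0v_1,v_0v_2,\ldots,v_0v_{n-4},\ v_1v_{n-3},\ v_2v_{n-2},\ v_3v_{n-1}\}$. $\lfloor x\rfloor$ is the greatest integer not exceeding $x$; $\mathbb N=\{1,2,\ldots\}$. *)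

theory Defs
  imports Main Complex_Main
begin

definition simple_graph :: "nat set \<Rightarrow> nat set set \<Rightarrow> bool" where
  "simple_graph V E \<longleftrightarrow> finite V \<and> (\<forall>e\<in>E. \<exists>u v. u \<noteq> v \<and> u \<in> V \<and> v \<in> V \<and> e = {u, v})"

definition contains_subgraph :: "nat set \<Rightarrow> nat set set \<Rightarrow> nat set \<Rightarrow> nat set set \<Rightarrow> bool" where
  "contains_subgraph V E VL EL \<longleftrightarrow>
     (\<exists>f. inj_on f VL \<and> f ` VL \<subseteq> V \<and> (\<forall>e\<in>EL. f ` e \<in> E))"

definition ex :: "nat \<Rightarrow> nat set \<Rightarrow> nat set set \<Rightarrow> nat" where
  "ex p VL EL = Max {card E | E. simple_graph {0..<p} E \<and> \<not> contains_subgraph {0..<p} E VL EL}"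

definition T3_vertices :: "nat \<Rightarrow> nat set" where
  "T3_vertices n = {0..<n}"

definition T3_edges :: "nat \<Rightarrow> nat set set" where
  "T3_edges n = {{0, i} | i. 1 \<le> i \<and> i \<le> n - 4} \<union> {{1, n - 3}, {2, n - 2}, {3, n - 1}}"

end

theory Submission
  imports Defs
begin

text \<open>
  Write \<open>q = n - 1\<close> and measure a graph on \<open>p\<close> vertices by its deficiency \<open>(q - 1) p - 2 e\<close>, the sum of
  \<open>q - 1 - deg u\<close> over its vertices. With \<open>r = p mod q\<close>, disjoint cliques \<open>K_q\<close> together with a \<open>K_r\<close> have
  deficiency \<open>r (q - r)\<close>, and replacing one \<open>K_q\<close> and the \<open>K_r\<close> by a nearly \<open>(q - 4)\<close>-regular graph on \<open>q + r\<close>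
  vertices gives \<open>3 (q + r)\<close> up to parity.

  For the lower bound on the deficiency, induct on \<open>p\<close> and take a vertex \<open>v\<close> of maximal degree \<open>d\<close>. If \<open>d \<le> q - 4\<close>,
  every vertex contributes at least 3. Otherwise the absence of the tree centred at \<open>v\<close> forbids three disjoint
  edges leaving the neighbourhood \<open>N\<close> of \<open>v\<close>, of which at most \<open>d - (q - 3)\<close> may end in \<open>N\<close> again.
  For \<open>d \<ge> q\<close> this bounds the number of edges touching \<open>N\<close>, so that \<open>v\<close> and \<open>N\<close> can be deleted. For smaller \<open>d\<close>
  either most vertices of \<open>N\<close> have small degree, or at most two vertices cover all edges between \<open>N\<close> and the
  rest, and adding these vertices to \<open>N\<close> and \<open>v\<close> yields a set of at most \<open>q\<close> vertices that may be split off, since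
  replacing the edges leaving it by edges inside it essentially does not decrease the number of edges.
\<close>

section \<open>Neighbourhoods, ordered edges and matchings\<close>

definition nbr :: "('a \<Rightarrow> 'a \<Rightarrow> bool) \<Rightarrow> 'a set \<Rightarrow> 'a \<Rightarrow> 'a set" where
  "nbr R V u = {w \<in> V. R u w}"

text \<open>Ordered pairs count every edge of a symmetric relation twice, which turns edge counts
  into degree sums and avoids halves.\<close>

definition arcs :: "('a \<Rightarrow> 'a \<Rightarrow> bool) \<Rightarrow> 'a set \<Rightarrow> ('a \<times> 'a) set" where
  "arcs R V = Sigma V (nbr R V)"

text \<open>The tree of the theorem is the spider with centre \<open>v\<close>, three legs \<open>v - x\<^sub>i - y\<^sub>i\<close> and \<open>n - 7 = q - 6\<close> further
  leaves at \<open>v\<close>.\<close>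

definition spider_free :: "nat \<Rightarrow> ('a \<Rightarrow> 'a \<Rightarrow> bool) \<Rightarrow> 'a set \<Rightarrow> bool" where
  "spider_free q R V \<longleftrightarrow>
     (\<forall>v x1 x2 x3 y1 y2 y3. {v, x1, x2, x3, y1, y2, y3} \<subseteq> V \<longrightarrow> distinct [v, x1, x2, x3, y1, y2, y3] \<longrightarrow>
        R v x1 \<longrightarrow> R v x2 \<longrightarrow> R v x3 \<longrightarrow> R x1 y1 \<longrightarrow> R x2 y2 \<longrightarrow> R x3 y3 \<longrightarrow>
        card (nbr R V v - {x1, x2, x3, y1, y2, y3}) < q - 6)"

text \<open>\<open>phi\<close> is the deficiency of the clique construction, \<open>psi\<close> the optimal one. The second construction needs at
  least \<open>q\<close> vertices, hence the case distinction.\<close>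

definition phi :: "nat \<Rightarrow> nat \<Rightarrow> nat" where
  "phi q m = (m mod q) * (q - m mod q)"

definition psi :: "nat \<Rightarrow> nat \<Rightarrow> nat" where
  "psi q m = (if m < q then phi q m else min (phi q m) (3 * (q + m mod q)))"

lemma finite_nbr [simp]: "finite V \<Longrightarrow> finite (nbr R V u)"
  by (simp add: nbr_def)

lemma finite_arcs [simp]: "finite V \<Longrightarrow> finite (arcs R V)"
  by (auto simp: arcs_def)

lemma card_arcs: "finite V \<Longrightarrow> card (arcs R V) = (\<Sum>u\<in>V. card (nbr R V u))"
  by (simp add: arcs_def)

lemma card_nbr_mono: "finite V \<Longrightarrow> U \<subseteq> V \<Longrightarrow> card (nbr R U u) \<le> card (nbr R V u)"
  by (intro card_mono) (auto simp: nbr_def)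

lemma card_arcs_le_complete:
  assumes "finite V" "irreflp R"
  shows "card (arcs R V) \<le> card V * (card V - 1)"
proof -
  have "card (nbr R V u) \<le> card V - 1" if "u \<in> V" for u
  proof -
    have "nbr R V u \<subseteq> V - {u}"
      using assms(2) by (auto simp: nbr_def irreflp_def)
    then have "card (nbr R V u) \<le> card (V - {u})"
      using assms(1) by (intro card_mono) auto
    then show ?thesis using that assms(1) by simp
  qed
  then show ?thesis
    using sum_bounded_above[of V "\<lambda>u. card (nbr R V u)" "card V - 1"] assms(1)
    by (simp add: card_arcs)
qed

text \<open>An arc without an end in \<open>C\<close> stays inside \<open>A\<close> or inside
  \<open>B\<close>. The remaining arcs start in \<open>C\<close> or are reversals of arcs that do,
  hence the factor 2.\<close>

lemma card_arcs_le_split: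
  assumes "finite V" "symp R" "V \<subseteq> A \<union> B \<union> C" "A \<subseteq> V" "B \<subseteq> V" "C \<subseteq> V"
    and sep: "\<And>a b. a \<in> A \<Longrightarrow> b \<in> B \<Longrightarrow> \<not> R a b"
  shows "card (arcs R V) \<le> card (arcs R A) + card (arcs R B) + 2 * (\<Sum>c\<in>C. card (nbr R V c))"
proof -
  let ?S = "Sigma C (nbr R V)"
  have fin: "finite A" "finite B" "finite C"
    using assms finite_subset by blast+
  have sub: "arcs R V \<subseteq> (arcs R A \<union> arcs R B) \<union> (?S \<union> prod.swap ` ?S)"
  proof
    fix e assume "e \<in> arcs R V"
    then obtain u w where e: "e = (u, w)" and uw: "u \<in> V" "w \<in> V" "R u w" "R w u"
      using assms(2) by (auto simp: arcs_def nbr_def dest: sympD)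
    consider "u \<in> C" | "w \<in> C" | "u \<in> A" "w \<in> A" | "u \<in> B" "w \<in> B"
      using uw sep[of u w] sep[of w u] assms(3) by blast
    then show "e \<in> (arcs R A \<union> arcs R B) \<union> (?S \<union> prod.swap ` ?S)"
    proof cases
      case 2
      then have "(w, u) \<in> ?S" using uw by (auto simp: nbr_def)
      then have "prod.swap (w, u) \<in> prod.swap ` ?S" by (rule imageI)
      then show ?thesis using e by simp
    qed (use uw e in \<open>auto simp: arcs_def nbr_def\<close>)
  qed
  have finS: "finite ?S" using fin assms(1) by auto
  have "card (arcs R V) \<le> card ((arcs R A \<union> arcs R B) \<union> (?S \<union> prod.swap ` ?S))"
    using fin finS by (intro card_mono sub) auto
  also have "\<dots> \<le> (card (arcs R A) + card (arcs R B)) + (card ?S + card (prod.swap ` ?S))"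
    by (meson add_mono card_Un_le order_trans)
  also have "card (prod.swap ` ?S) = card ?S"
    by (intro card_image) auto
  finally show ?thesis using fin assms(1) by simp
qed

lemma card_arcs_le_cover:
  assumes "finite V" "symp R" "C \<subseteq> V"
    and "\<And>u w. u \<in> V \<Longrightarrow> w \<in> V \<Longrightarrow> R u w \<Longrightarrow> u \<in> C \<or> w \<in> C"
    and "\<And>c. c \<in> C \<Longrightarrow> card (nbr R V c) \<le> d"
  shows "card (arcs R V) \<le> 2 * (card C * d)"
proof -
  have "arcs R (V - C) = {}" unfolding arcs_def nbr_def using assms(4) by blast
  moreover have "card (arcs R V) \<le> card (arcs R (V - C)) + card (arcs R {}) + 2 * (\<Sum>c\<in>C. card (nbr R V c))"
  proof (rule card_arcs_le_split)
    show "\<And>a b. a \<in> V - C \<Longrightarrow> b \<in> {} \<Longrightarrow> \<not> R a b" by simp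
  qed (use assms in auto)
  moreover have "(\<Sum>c\<in>C. card (nbr R V c)) \<le> card C * d"
    using sum_bounded_above[of C "\<lambda>c. card (nbr R V c)" d] assms(5) by simp
  ultimately show ?thesis by (simp add: arcs_def)
qed

lemma card_arcs_le_delete:
  assumes "finite V" "symp R" "a \<in> V"
  shows "card (arcs R V) \<le> card (arcs R (V - {a})) + 2 * card (nbr R V a)"
  using card_arcs_le_split[of V R "V - {a}" "{}" "{a}"] assms by (auto simp: arcs_def)

lemma ex_nbr_notin:
  assumes "finite V" "finite A" "card A < card (nbr R V a)"
  obtains z where "z \<in> V" "R a z" "z \<notin> A"
proof -
  have "\<not> nbr R V a \<subseteq> A" using assms card_mono[of A "nbr R V a"] by auto
  then show ?thesis using that by (auto simp: nbr_def)
qed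

text \<open>A vertex \<open>b\<close> of degree 3 keeps a neighbour off any edge that avoids
  \<open>b\<close>, so all edges contain \<open>b\<close>. If all degrees are at most 2, the two
  ends of one edge meet every edge, which leaves at most 8 arcs; this is where
  \<open>4 \<le> d\<close> enters.\<close>

lemma card_arcs_le_no_two_disjoint:
  assumes "finite V" "symp R" "irreflp R"
    and deg: "\<And>u. u \<in> V \<Longrightarrow> card (nbr R V u) \<le> d" and "4 \<le> d"
    and free: "\<And>a b a' b'. {a, b, a', b'} \<subseteq> V \<Longrightarrow> distinct [a, b, a', b'] \<Longrightarrow> R a b \<Longrightarrow> R a' b' \<Longrightarrow> False"
  shows "card (arcs R V) \<le> 2 * d"
proof (cases "\<exists>b\<in>V. 3 \<le> card (nbr R V b)")
  case True
  then obtain b where b: "b \<in> V" "3 \<le> card (nbr R V b)" by blast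
  have "x = b \<or> y = b" if xy: "x \<in> V" "y \<in> V" "R x y" for x y
  proof (rule ccontr)
    assume nb: "\<not> ?thesis"
    have "card {x, y} \<le> 2" by (simp add: card_insert_if)
    with b obtain z where "z \<in> V" "R b z" "z \<notin> {x, y}"
      using ex_nbr_notin[of V "{x, y}" R b] assms(1) by auto
    then show False
      using free[of b z x y] b xy nb assms(3) by (auto simp: irreflp_def)
  qed
  then show ?thesis using card_arcs_le_cover[of V R "{b}" d] assms b by auto
next
  case no3: False
  show ?thesis
  proof (cases "\<exists>x\<in>V. \<exists>y\<in>V. R x y")
    case True
    then obtain x y where xy: "x \<in> V" "y \<in> V" "R x y" by blast
    have "u \<in> {x, y} \<or> w \<in> {x, y}" if "u \<in> V" "w \<in> V" "R u w" for u w
      using free[of x y u w] that xy assms(3) by (auto simp: irreflp_def)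
    moreover have "card (nbr R V c) \<le> 2" if "c \<in> V" for c
    proof -
      have "\<not> 3 \<le> card (nbr R V c)" using no3 that by blast
      then show ?thesis by linarith
    qed
    ultimately have "card (arcs R V) \<le> 2 * (card {x, y} * 2)"
      using assms(1,2) xy by (intro card_arcs_le_cover) (assumption | blast)+
    moreover have "card {x, y} \<le> 2" by (simp add: card_insert_if)
    ultimately show ?thesis using \<open>4 \<le> d\<close> by linarith
  next
    case False
    then have "arcs R V = {}" by (auto simp: arcs_def nbr_def)
    then show ?thesis by simp
  qed
qed

text \<open>Two disjoint edges occupy four vertices, so a vertex of degree 5 off them would add a
  third; deleting it reduces to \<open>card_arcs_le_no_two_disjoint\<close>. If all degrees are at
  most 4, the four ends of two disjoint edges meet every edge, giving at most 32 arcs, hence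
  \<open>8 \<le> d\<close>.\<close>

lemma card_arcs_le_no_three_disjoint:
  assumes "finite V" "symp R" "irreflp R"
    and deg: "\<And>u. u \<in> V \<Longrightarrow> card (nbr R V u) \<le> d" and "8 \<le> d"
    and free: "\<And>a b a' b' a'' b''. {a, b, a', b', a'', b''} \<subseteq> V \<Longrightarrow> distinct [a, b, a', b', a'', b''] \<Longrightarrow>
      R a b \<Longrightarrow> R a' b' \<Longrightarrow> R a'' b'' \<Longrightarrow> False"
  shows "card (arcs R V) \<le> 4 * d"
proof (cases "\<exists>a\<in>V. 5 \<le> card (nbr R V a)")
  case True
  then obtain a where a: "a \<in> V" "5 \<le> card (nbr R V a)" by blast
  have "card (arcs R (V - {a})) \<le> 2 * d"
  proof (rule card_arcs_le_no_two_disjoint)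
    show "card (nbr R (V - {a}) u) \<le> d" if "u \<in> V - {a}" for u
      using deg[of u] that card_nbr_mono[of V "V - {a}" R u] assms(1) by auto
    fix x y x' y'
    assume *: "{x, y, x', y'} \<subseteq> V - {a}" "distinct [x, y, x', y']" "R x y" "R x' y'"
    have "card {x, y, x', y'} \<le> 4" by (simp add: card_insert_if)
    with a obtain z where "z \<in> V" "R a z" "z \<notin> {x, y, x', y'}"
      using ex_nbr_notin[of V "{x, y, x', y'}" R a] assms(1) by auto
    then show False
      using free[of a z x y x' y'] a * assms(3) by (auto simp: irreflp_def)
  qed (use assms in auto)
  then show ?thesis
    using card_arcs_le_delete[of V R a] deg[of a] assms(1,2) a by linarith
next
  case no5: False
  show ?thesis
  proof (cases "\<exists>a b a' b'. {a, b, a', b'} \<subseteq> V \<and> distinct [a, b, a', b'] \<and> R a b \<and> R a' b'")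
    case True
    then obtain a b a' b' where *: "{a, b, a', b'} \<subseteq> V" "distinct [a, b, a', b']" "R a b" "R a' b'"
      by blast
    have "u \<in> {a, b, a', b'} \<or> w \<in> {a, b, a', b'}" if "u \<in> V" "w \<in> V" "R u w" for u w
      using free[of a b a' b' u w] that * assms(3) by (auto simp: irreflp_def)
    moreover have "card (nbr R V c) \<le> 4" if "c \<in> V" for c
    proof -
      have "\<not> 5 \<le> card (nbr R V c)" using no5 that by blast
      then show ?thesis by linarith
    qed
    ultimately have "card (arcs R V) \<le> 2 * (card {a, b, a', b'} * 4)"
      using assms(1,2) *(1) by (intro card_arcs_le_cover) (assumption | blast)+
    moreover have "card {a, b, a', b'} \<le> 4" by (simp add: card_insert_if)
    ultimately show ?thesis using \<open>8 \<le> d\<close> by linarith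
  next
    case False
    have "card (arcs R V) \<le> 2 * d"
    proof (rule card_arcs_le_no_two_disjoint)
      show "\<And>a b a' b'. {a, b, a', b'} \<subseteq> V \<Longrightarrow> distinct [a, b, a', b'] \<Longrightarrow> R a b \<Longrightarrow> R a' b' \<Longrightarrow> False"
        using False by blast
    qed (use assms in auto)
    then show ?thesis by simp
  qed
qed

section \<open>The optimal deficiency\<close>

lemma phi_le:
  assumes "0 < q"
  shows "4 * phi q m \<le> q * q"
proof -
  define a b where "a = m mod q" and "b = q - m mod q"
  have q: "q = a + b"
    unfolding a_def b_def using mod_less_divisor[OF assms, of m] by linarith
  have "4 * (a * b) \<le> (a + b) * (a + b)"
  proof (cases "a \<le> b")
    case True
    then obtain t where "b = a + t" using le_Suc_ex by blast
    then show ?thesis by (simp add: algebra_simps)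
  next
    case False
    then obtain t where "a = b + t" using le_Suc_ex nat_le_linear by blast
    then show ?thesis by (simp add: algebra_simps)
  qed
  then have "4 * (a * b) \<le> q * q" unfolding q .
  then show ?thesis by (simp only: phi_def a_def b_def)
qed

lemma psi_le_phi: "psi q m \<le> phi q m"
  by (simp add: psi_def)

lemma mod_add_cases:
  fixes q x y :: nat
  assumes "0 < q" "x \<le> q"
  shows "(y + x) mod q = (if y mod q + x < q then y mod q + x else y mod q + x - q)"
proof -
  have "y mod q < q" using assms by simp
  with assms have "\<not> y mod q + x < q \<Longrightarrow> y mod q + x - q < q" by linarith
  then have "(y mod q + x) mod q = (if y mod q + x < q then y mod q + x else y mod q + x - q)"
    using assms by (auto simp: le_mod_geq)
  then show ?thesis by (simp add: mod_add_left_eq)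
qed

text \<open>\<open>x * (q - x)\<close> is the deficiency of a clique on \<open>x\<close> vertices.
  With \<open>r\<close> the residue of \<open>y\<close>, the two sides differ by
  \<open>2 * r * x\<close> if \<open>r + x\<close> stays below \<open>q\<close>, and by
  \<open>2 * (q - r) * (q - x)\<close> otherwise.\<close>

lemma phi_add_le:
  assumes "0 < q" "x \<le> q"
  shows "phi q (y + x) \<le> x * (q - x) + phi q y"
proof -
  define r where "r = y mod q"
  have r: "r < q" using assms by (simp add: r_def)
  show ?thesis
  proof (cases "r + x < q")
    case True
    define c where "c = q - (r + x)"
    have q: "q = r + x + c" using True by (simp add: c_def)
    have "phi q (y + x) = (r + x) * c"
      using mod_add_cases[OF assms, of y] True by (simp add: phi_def r_def[symmetric] c_def)
    moreover have "phi q y = r * (x + c)" unfolding phi_def r_def[symmetric] using q by simp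
    ultimately show ?thesis by (simp add: q algebra_simps)
  next
    case False
    define a b c where "a = q - r" and "b = q - x" and "c = r + x - q"
    have q: "q = a + b + c" "r = b + c" "x = a + c"
      using False r assms by (auto simp: a_def b_def c_def)
    have "(y + x) mod q = c"
      using mod_add_cases[OF assms, of y] False by (simp add: r_def c_def)
    then have "phi q (y + x) = c * (a + b)"
      unfolding phi_def using q(1) by simp
    moreover have "phi q y = (b + c) * a" unfolding phi_def r_def[symmetric] using q(1,2) by simp
    moreover have "x * (q - x) = (a + c) * b" using q(1,3) by simp
    ultimately show ?thesis by (simp add: algebra_simps)
  qed
qed

lemma phi_le_double:
  assumes "q \<le> m mod q + 2" "0 < q"
  shows "phi q m \<le> 2 * q"
proof -
  have "phi q m \<le> q * 2"
    unfolding phi_def using assms by (intro mult_le_mono) auto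
  then show ?thesis by simp
qed

text \<open>This inequality permits splitting off \<open>x\<close> vertices. If the second term of
  the minimum is active at \<open>y\<close>: a residue that wraps around does not grow; for
  \<open>x \<le> q - 3\<close> the increase \<open>3 * x\<close> is paid by
  \<open>x * (q - x)\<close>; for larger \<open>x\<close> the new residue is at least
  \<open>q - 2\<close>, where \<open>phi\<close> is at most \<open>2 * q\<close>.\<close>

lemma psi_add_le:
  assumes "0 < q" "x \<le> q"
  shows "psi q (y + x) \<le> x * (q - x) + psi q y"
proof (cases "psi q y = phi q y")
  case True
  then show ?thesis using phi_add_le[OF assms, of y] psi_le_phi[of q "y + x"] by linarith
next
  case False
  then have y: "q \<le> y" "psi q y = 3 * (q + y mod q)"
    by (auto simp: psi_def min_def split: if_splits)
  have m: "(y + x) mod q = (if y mod q + x < q then y mod q + x else y mod q + x - q)"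
    by (rule mod_add_cases[OF assms])
  have *: "psi q (y + x) \<le> 3 * (q + (y + x) mod q)" using y by (auto simp: psi_def)
  consider "q \<le> y mod q + x" | "y mod q + x < q" "x + 3 \<le> q" | "y mod q + x < q" "q < x + 3"
    by linarith
  then show ?thesis
  proof cases
    case 2
    have "x * 3 \<le> x * (q - x)" using 2 by (intro mult_le_mono) auto
    then have "3 * (q + (y mod q + x)) \<le> x * (q - x) + 3 * (q + y mod q)" by simp
    moreover have "psi q (y + x) \<le> 3 * (q + (y mod q + x))" using * 2(1) unfolding m by simp
    ultimately show ?thesis using y(2) by (metis order_trans)
  next
    case 3
    then have "phi q (y + x) \<le> 2 * q" by (intro phi_le_double) (use m assms in auto)
    moreover have "2 * q \<le> x * (q - x) + 3 * (q + y mod q)" by simp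
    ultimately show ?thesis using psi_le_phi[of q "y + x"] unfolding y(2) by (meson order_trans)
  qed (use * y m assms in simp)
qed

text \<open>Splitting off \<open>q - 2\<close> vertices shifts the residue up by 2. The surplus of 2
  on the left pays for the one edge that is missing in the case of degree
  \<open>q - 3\<close>.\<close>

lemma psi_add_le_strict:
  assumes "2 < q" "q \<le> p" "p mod q + 2 < q"
  shows "psi q p + 2 \<le> 2 * (q - 2) + psi q (p - (q - 2))"
proof -
  define r where "r = p mod q"
  define c where "c = q - r - 3"
  have q: "q = r + c + 3" using assms by (simp add: r_def c_def)
  have p: "p - (q - 2) = (p - q) + 2" using assms by simp
  have "(p - q) mod q = r" using assms by (simp add: r_def le_mod_geq)
  then have m: "(p - (q - 2)) mod q = r + 2"
    using mod_add_cases[of q 2 "p - q"] assms by (simp add: p r_def)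
  have 1: "psi q p \<le> phi q p" "psi q p \<le> 3 * (q + r)"
    using assms by (auto simp: psi_def r_def)
  have 2: "phi q p = r * (c + 3)" unfolding phi_def r_def[symmetric] using q by simp
  have 3: "phi q (p - (q - 2)) = (r + 2) * (c + 1)" unfolding phi_def m using q by simp
  have "psi q (p - (q - 2)) = phi q (p - (q - 2)) \<or> psi q (p - (q - 2)) = 3 * (q + (r + 2))"
    using m by (auto simp: psi_def min_def)
  then have "2 * (r + c + 1) + psi q (p - (q - 2)) \<ge> psi q p + 2"
  proof
    assume *: "psi q (p - (q - 2)) = phi q (p - (q - 2))"
    have "r * (c + 3) + 2 \<le> 2 * (r + c + 1) + (r + 2) * (c + 1)"
      by (simp add: algebra_simps)
    moreover have "psi q p + 2 \<le> r * (c + 3) + 2" using 1(1) unfolding 2 by simp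
    ultimately show ?thesis unfolding * 3 by (rule order_trans[rotated])
  next
    assume *: "psi q (p - (q - 2)) = 3 * (q + (r + 2))"
    show ?thesis unfolding * using 1(2) by simp
  qed
  moreover have "2 * (q - 2) = 2 * (r + c + 1)" using q by simp
  ultimately show ?thesis by simp
qed

section \<open>The upper bound\<close>

lemma spider_free_subset:
  fixes R :: "'a \<Rightarrow> 'a \<Rightarrow> bool"
  assumes "spider_free q R V" "U \<subseteq> V" "finite V"
  shows "spider_free q R U"
  unfolding spider_free_def
proof (intro allI impI)
  fix v x1 x2 x3 y1 y2 y3 :: 'a
  let ?F = "{x1, x2, x3, y1, y2, y3}"
  assume *: "{v, x1, x2, x3, y1, y2, y3} \<subseteq> U" "distinct [v, x1, x2, x3, y1, y2, y3]"
    "R v x1" "R v x2" "R v x3" "R x1 y1" "R x2 y2" "R x3 y3"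
  have "{v, x1, x2, x3, y1, y2, y3} \<subseteq> V" using *(1) assms(2) by (rule order_trans)
  then have "card (nbr R V v - ?F) < q - 6"
    using assms(1) *(2-) unfolding spider_free_def by presburger
  moreover have "card (nbr R U v - ?F) \<le> card (nbr R V v - ?F)"
    using assms(2,3) by (intro card_mono) (auto simp: nbr_def)
  ultimately show "card (nbr R U v - ?F) < q - 6" by linarith
qed

text \<open>Koenig's theorem for matchings of size at most one. A pair that avoids \<open>a\<close>
  must end in \<open>b\<close>, and together with \<open>a\<close>, \<open>b\<close> it forces every
  pair to end in \<open>b\<close>.\<close>

lemma two_disjoint_or_cover:
  assumes "\<And>x y. P x y \<Longrightarrow> x \<in> A \<and> y \<in> B"
    and "\<And>x y x' y'. P x y \<Longrightarrow> P x' y' \<Longrightarrow> x \<noteq> x' \<Longrightarrow> y \<noteq> y' \<Longrightarrow> False"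
  obtains X Y where "X \<subseteq> A" "Y \<subseteq> B" "finite X" "finite Y" "card X + card Y \<le> 1"
    "\<And>x y. P x y \<Longrightarrow> x \<in> X \<or> y \<in> Y"
proof (cases "\<exists>a b. P a b")
  case False
  then show ?thesis using that[of "{}" "{}"] by auto
next
  case True
  then obtain a b where ab: "P a b" by blast
  show ?thesis
  proof (cases "\<forall>x y. P x y \<longrightarrow> x = a")
    case True
    then show ?thesis using that[of "{a}" "{}"] assms(1)[OF ab] by auto
  next
    case False
    then obtain x y where xy: "P x y" "x \<noteq> a" by blast
    have "y' = b" if "P x' y'" for x' y'
    proof (rule ccontr)
      assume "y' \<noteq> b"
      then show False using assms(2)[OF ab that] assms(2)[OF ab xy(1)] assms(2)[OF xy(1) that] xy(2) by auto
    qed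
    then show ?thesis using that[of "{}" "{b}"] assms(1)[OF ab] by auto
  qed
qed

text \<open>Koenig's theorem for matchings of size at most two.\<close>

lemma three_disjoint_or_cover:
  assumes PAB: "\<And>x y. P x y \<Longrightarrow> x \<in> A \<and> y \<in> B"
    and free: "\<And>x1 y1 x2 y2 x3 y3. P x1 y1 \<Longrightarrow> P x2 y2 \<Longrightarrow> P x3 y3 \<Longrightarrow>
      distinct [x1, x2, x3] \<Longrightarrow> distinct [y1, y2, y3] \<Longrightarrow> False"
  obtains X Y where "X \<subseteq> A" "Y \<subseteq> B" "finite X" "finite Y" "card X + card Y \<le> 2"
    "\<And>x y. P x y \<Longrightarrow> x \<in> X \<or> y \<in> Y"
proof (cases "\<exists>x1 y1 x2 y2. P x1 y1 \<and> P x2 y2 \<and> x1 \<noteq> x2 \<and> y1 \<noteq> y2")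
  case False
  then obtain X Y where "X \<subseteq> A" "Y \<subseteq> B" "finite X" "finite Y" "card X + card Y \<le> 1"
    "\<And>x y. P x y \<Longrightarrow> x \<in> X \<or> y \<in> Y"
    using two_disjoint_or_cover[of P A B] PAB by metis
  then show ?thesis using that[of X Y] by simp
next
  case True
  then obtain x1 y1 x2 y2 where m: "P x1 y1" "P x2 y2" "x1 \<noteq> x2" "y1 \<noteq> y2" by blast
  \<comment> \<open>An augmenting path argument. The right end \<open>a'\<close> can be matched to
    \<open>c\<close> instead of \<open>a\<close>, so a pair \<open>u\<close>, \<open>w\<close> with
    a new right end must start at \<open>b\<close>. Any pair avoiding both \<open>b\<close> and
    \<open>a'\<close> would then complete three disjoint pairs.\<close>
  have aux: "\<forall>x y. P x y \<longrightarrow> x = b \<or> y = a'"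
    if m': "P a a'" "P b b'" "a \<noteq> b" "a' \<noteq> b'" and e: "P c a'" "c \<noteq> a" "c \<noteq> b"
      and f: "P u w" "w \<noteq> a'" "w \<noteq> b'" for a a' b b' c u w
  proof -
    have u: "u = b" using free[of c a' b b' u w] free[of a a' b b' u w] free[of c a' a w b b'] m' e f
      by auto
    show ?thesis
    proof (intro allI impI, rule ccontr)
      fix x y assume xy: "P x y" "\<not> (x = b \<or> y = a')"
      show False
      proof (cases "x = a")
        case True
        then show False using free[of c a' a y b b'] free[of c a' a b' b w] m' e f u xy by auto
      next
        case False
        then show False using free[of a a' b b' x y] free[of a a' b w x b'] m' e f u xy by auto
      qed
    qed
  qed
  consider "\<forall>x y. P x y \<longrightarrow> x = x1 \<or> x = x2" | "\<forall>x y. P x y \<longrightarrow> y = y1 \<or> y = y2"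
    | c b u w where "P c b" "c \<noteq> x1" "c \<noteq> x2" "P u w" "w \<noteq> y1" "w \<noteq> y2"
    by blast
  then show ?thesis
  proof cases
    case 1
    then show ?thesis
      using that[of "{x1, x2}" "{}"] m PAB by (auto simp: card_insert_if)
  next
    case 2
    then show ?thesis
      using that[of "{}" "{y1, y2}"] m PAB by (auto simp: card_insert_if)
  next
    case 3
    have "b = y1 \<or> b = y2" using free[of x1 y1 x2 y2 c b] m 3 by auto
    then show ?thesis
    proof
      assume "b = y1"
      then have "\<forall>x y. P x y \<longrightarrow> x = x2 \<or> y = y1"
        using aux[of x1 y1 x2 y2 c u w] m 3 by blast
      then show ?thesis using that[of "{x2}" "{y1}"] m PAB by auto
    next
      assume "b = y2"
      then have "\<forall>x y. P x y \<longrightarrow> x = x1 \<or> y = y2"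
        using aux[of x2 y2 x1 y1 c u w] m 3 by blast
      then show ?thesis using that[of "{x1}" "{y2}"] m PAB by auto
    qed
  qed
qed

section \<open>The induction step at a vertex of maximal degree\<close>

locale extremal_step =
  fixes q :: nat and R :: "'a \<Rightarrow> 'a \<Rightarrow> bool" and V :: "'a set" and v :: 'a
  assumes finV: "finite V" and symR: "symp R" and irrR: "irreflp R"
    and free: "spider_free q R V" and q9: "9 \<le> q" and q_less: "q < card V"
    and vV: "v \<in> V" and max_deg: "\<And>u. u \<in> V \<Longrightarrow> card (nbr R V u) \<le> card (nbr R V v)"
    and IH: "\<And>U. U \<subset> V \<Longrightarrow> card (arcs R U) + psi q (card U) \<le> (q - 1) * card U"
begin

abbreviation N where "N \<equiv> nbr R V v"
abbreviation d where "d \<equiv> card N"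
abbreviation W where "W \<equiv> V - insert v N"

lemma R_sym: "R x y \<Longrightarrow> R y x"
  using symR by (rule sympD)

lemma R_irrefl: "\<not> R x x"
  using irrR by (simp add: irreflp_def)

lemma finN: "finite N" and N_subset: "N \<subseteq> V" and v_notin_N: "v \<notin> N"
  using finV R_irrefl by (auto simp: nbr_def)

lemma four_psi_le: "4 * psi q (card V) \<le> q * q"
  using phi_le[of q "card V"] psi_le_phi[of q "card V"] q9 by linarith

lemma card_V: "card V = card W + (d + 1)"
proof -
  have "card V = card W + card (insert v N)"
    using finV vV N_subset by (metis card_Diff_subset card_mono finite_insert finN insert_subset le_add_diff_inverse2)
  then show ?thesis using finN v_notin_N by simp
qed

text \<open>The legs take from \<open>N\<close> only the three inner vertices and the feet collected
  in \<open>Y\<close>. If \<open>d\<close> were at least \<open>q - 3 + j\<close>, then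
  \<open>q - 6\<close> further neighbours would remain as leaves and complete a spider.\<close>

lemma no_spider:
  assumes "x1 \<in> N" "x2 \<in> N" "x3 \<in> N" "R x1 y1" "R x2 y2" "R x3 y3"
    and "distinct [v, x1, x2, x3, y1, y2, y3]" "{y1, y2, y3} \<subseteq> V"
    and "finite Y" "card Y \<le> j" "{y1, y2, y3} \<inter> N \<subseteq> Y"
  shows "d < q - 3 + j"
proof -
  let ?F = "{x1, x2, x3, y1, y2, y3}"
  have "{v, x1, x2, x3, y1, y2, y3} \<subseteq> V" using assms(1-3,8) vV N_subset by auto
  moreover have "R v x1" "R v x2" "R v x3" using assms(1-3) by (auto simp: nbr_def)
  ultimately have 1: "card (N - ?F) < q - 6"
    using free assms(4-7) unfolding spider_free_def by presburger
  have "N \<subseteq> (N - ?F) \<union> ({x1, x2, x3} \<union> Y)" using assms(11) by auto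
  then have "d \<le> card ((N - ?F) \<union> ({x1, x2, x3} \<union> Y))"
    using finN assms(9) by (intro card_mono) auto
  also have "\<dots> \<le> card (N - ?F) + (card {x1, x2, x3} + card Y)"
    by (meson add_left_mono card_Un_le order_trans)
  finally have "d \<le> card (N - ?F) + (3 + j)"
    using assms(10) card_insert_le_m1[of 3 "{x2,x3}" x1] by (simp add: card_insert_if split: if_splits)
  then show ?thesis using 1 q9 by linarith
qed

text \<open>The set \<open>A \<union> C\<close> of at most \<open>q\<close> vertices is split off. The last assumption says that the edges inside \<open>A\<close> and
  those touching \<open>C\<close>, including the ones towards \<open>B\<close>, are no more than those of a clique on \<open>A \<union> C\<close>.\<close>

lemma bound_by_cut:
  assumes part: "V = A \<union> B \<union> C" "A \<inter> B = {}" "A \<inter> C = {}" "B \<inter> C = {}" "A \<noteq> {}"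
    and sep: "\<And>a b. a \<in> A \<Longrightarrow> b \<in> B \<Longrightarrow> \<not> R a b"
    and x: "x = card A + card C" "x \<le> q"
    and le: "card A * (card A - 1) + 2 * (card C * d) \<le> x * (x - 1)"
  shows "card (arcs R V) + psi q (card V) \<le> (q - 1) * card V"
proof -
  have fin: "finite A" "finite B" "finite C" using finV part(1) by auto
  have V: "card V = card B + x"
  proof -
    have "card V = card (A \<union> C) + card B"
      unfolding part(1) using fin part(2,4) by (subst card_Un_disjoint[symmetric]) (auto intro: arg_cong[where f = card])
    then show ?thesis using fin part(3) x(1) by (simp add: card_Un_disjoint)
  qed
  have "x \<noteq> 0" using x fin part(5) by auto
  have "card (arcs R V) \<le> card (arcs R A) + card (arcs R B) + 2 * (\<Sum>c\<in>C. card (nbr R V c))"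
    using finV symR part(1) sep by (intro card_arcs_le_split) auto
  moreover have "(\<Sum>c\<in>C. card (nbr R V c)) \<le> card C * d"
    using sum_bounded_above[of C "\<lambda>c. card (nbr R V c)" d] max_deg part(1) by auto
  moreover have "card (arcs R A) \<le> card A * (card A - 1)"
    using fin irrR by (intro card_arcs_le_complete)
  moreover have "card (arcs R B) + psi q (card B) \<le> (q - 1) * card B"
    by (rule IH) (use part in auto)
  moreover have "psi q (card V) \<le> x * (q - x) + psi q (card B)"
    unfolding V using q9 x by (intro psi_add_le) auto
  moreover have "(q - 1) * card V = (q - 1) * card B + (x * (x - 1) + x * (q - x))"
  proof -
    have "x * (x - 1) + x * (q - x) = x * (q - 1)"
      using \<open>x \<noteq> 0\<close> x(2) by (simp flip: distrib_left)
    then show ?thesis by (simp add: V distrib_left)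
  qed
  ultimately show ?thesis using le by linarith
qed

lemma oriented:
  assumes "a \<in> N \<or> b \<in> N" "R a b"
  obtains x y where "x \<in> N" "R x y" "x = a \<and> y = b \<or> x = b \<and> y = a"
  using assms R_sym by blast

text \<open>Three disjoint edges of \<open>H\<close> would be legs of a spider: even with all feet
  in \<open>N\<close>, enough leaves remain. Together with the edges at \<open>v\<close>, at most
  \<open>6 * d\<close> arcs are lost on passing to \<open>W\<close>, and for
  \<open>9 \<le> q \<le> d\<close> the allowance \<open>(q - 1) * (d + 1)\<close> exceeds this by at
  least a quarter of \<open>q * q\<close>.\<close>

lemma bound_large_degree:
  assumes "q \<le> d"
  shows "card (arcs R V) + psi q (card V) \<le> (q - 1) * card V"
proof -
  define H where "H = (\<lambda>u w. R u w \<and> u \<noteq> v \<and> w \<noteq> v \<and> (u \<in> N \<or> w \<in> N))"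
  have "card (arcs H V) \<le> 4 * d"
  proof (rule card_arcs_le_no_three_disjoint)
    show "symp H" using R_sym by (auto simp: H_def intro!: sympI)
    show "irreflp H" using R_irrefl by (auto simp: H_def irreflp_def)
    show "card (nbr H V u) \<le> d" if "u \<in> V" for u
    proof -
      have "card (nbr H V u) \<le> card (nbr R V u)"
        using finV by (intro card_mono) (auto simp: nbr_def H_def)
      then show ?thesis using max_deg[OF that] by linarith
    qed
    fix a b a' b' a'' b''
    assume *: "{a, b, a', b', a'', b''} \<subseteq> V" "distinct [a, b, a', b', a'', b'']"
      "H a b" "H a' b'" "H a'' b''"
    obtain x1 y1 where 1: "x1 \<in> N" "R x1 y1" "x1 = a \<and> y1 = b \<or> x1 = b \<and> y1 = a"
      using *(3) oriented[of a b] unfolding H_def by blast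
    obtain x2 y2 where 2: "x2 \<in> N" "R x2 y2" "x2 = a' \<and> y2 = b' \<or> x2 = b' \<and> y2 = a'"
      using *(4) oriented[of a' b'] unfolding H_def by blast
    obtain x3 y3 where 3: "x3 \<in> N" "R x3 y3" "x3 = a'' \<and> y3 = b'' \<or> x3 = b'' \<and> y3 = a''"
      using *(5) oriented[of a'' b''] unfolding H_def by blast
    have "v \<notin> {a, b, a', b', a'', b''}" using *(3-5) by (auto simp: H_def)
    then have "distinct [v, x1, x2, x3, y1, y2, y3]" "{y1, y2, y3} \<subseteq> V"
      using 1(3) 2(3) 3(3) *(1,2) by (elim disjE; force)+
    then have "d < q - 3 + 3"
      using 1 2 3 by (intro no_spider[of x1 x2 x3 y1 y2 y3 "{y1, y2, y3}"]) (auto simp: card_insert_if)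
    then show False using assms q9 by linarith
  qed (use finV assms q9 in auto)
  moreover have "card (arcs R V) \<le> card (arcs R W) + 2 * d + card (arcs H V)"
  proof -
    have "arcs R V \<subseteq> (arcs R W \<union> ({v} \<times> N \<union> N \<times> {v})) \<union> arcs H V"
      using R_sym by (auto simp: arcs_def nbr_def H_def)
    then have "card (arcs R V) \<le> card ((arcs R W \<union> ({v} \<times> N \<union> N \<times> {v})) \<union> arcs H V)"
      using finV finN by (intro card_mono) auto
    also have "\<dots> \<le> (card (arcs R W) + (card ({v} \<times> N) + card (N \<times> {v}))) + card (arcs H V)"
      by (meson add_mono card_Un_le order_refl order_trans)
    finally show ?thesis by (simp add: card_cartesian_product)
  qed
  moreover have "card (arcs R W) + psi q (card W) \<le> (q - 1) * card W"
    by (rule IH) (use vV in auto)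
  moreover have "psi q (card V) + 6 * d \<le> (q - 1) * (d + 1)"
  proof -
    obtain i where i: "q = 9 + i" using q9 le_Suc_ex by blast
    obtain j where j: "d = 9 + i + j" using assms le_Suc_ex unfolding i by blast
    have "q * q + 24 * d \<le> 4 * ((q - 1) * (d + 1))"
      unfolding j unfolding i by (simp add: algebra_simps)
    then show ?thesis using four_psi_le by linarith
  qed
  moreover have "(q - 1) * card V = (q - 1) * card W + (q - 1) * (d + 1)"
    unfolding card_V by (rule distrib_left)
  ultimately show ?thesis by linarith
qed

lemma card_arcs_le_subset:
  assumes "M \<subseteq> V" "(\<Sum>u\<in>M. card (nbr R V u)) \<le> s"
  shows "card (arcs R V) \<le> s + d * (card V - card M)"
proof -
  have "card (arcs R V) = (\<Sum>u\<in>V - M. card (nbr R V u)) + (\<Sum>u\<in>M. card (nbr R V u))"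
    unfolding card_arcs[OF finV] using assms(1) finV by (rule sum.subset_diff)
  moreover have "(\<Sum>u\<in>V - M. card (nbr R V u)) \<le> card (V - M) * d"
    using sum_bounded_above[of "V - M" "\<lambda>u. card (nbr R V u)" d] max_deg by auto
  moreover have "card (V - M) = card V - card M"
    using assms(1) finV by (meson card_Diff_subset finite_subset)
  ultimately show ?thesis using assms(2) by (simp add: mult.commute)
qed

text \<open>If no edge leaves \<open>N\<close>, the \<open>q\<close> vertices of
  \<open>insert v N\<close> are cut off. An edge \<open>x\<close>, \<open>y\<close> leaving
  \<open>N\<close> is a leg with its foot outside \<open>N\<close>, so at most two feet fall into
  \<open>N\<close>; hence among the edges that meet \<open>N\<close> and avoid \<open>v\<close>,
  \<open>x\<close>, \<open>y\<close> no two are disjoint.\<close>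

lemma bound_degree_q_minus_1:
  assumes d: "d = q - 1"
  shows "card (arcs R V) + psi q (card V) \<le> (q - 1) * card V"
proof (cases "\<exists>x\<in>N. \<exists>y\<in>W. R x y")
  case False
  show ?thesis
  proof (rule bound_by_cut)
    show "\<not> R a b" if "a \<in> insert v N" "b \<in> W" for a b
      using False that by (auto simp: nbr_def)
    have c: "card (insert v N) = q" using d q9 finN v_notin_N by simp
    show "q = card (insert v N) + card {}" using c by simp
    show "card (insert v N) * (card (insert v N) - 1) + 2 * (card {} * d) \<le> q * (q - 1)"
      unfolding c by simp
  qed (use vV N_subset in auto)
next
  case True
  then obtain x y where xy: "x \<in> N" "y \<in> W" "R x y" by blast
  define V' where "V' = V - {v, x, y}"
  define H where "H = (\<lambda>u w. R u w \<and> (u \<in> N \<or> w \<in> N))"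
  have "card (arcs H V') \<le> 2 * (q - 2)"
  proof (rule card_arcs_le_no_two_disjoint)
    show "symp H" using R_sym by (auto simp: H_def intro!: sympI)
    show "irreflp H" using R_irrefl by (auto simp: H_def irreflp_def)
    \<comment> \<open>One below the maximal degree: a vertex of \<open>N\<close> loses its neighbour
      \<open>v\<close>, and any other vertex sees under \<open>H\<close> only \<open>N\<close>
      without \<open>x\<close>.\<close>
    show "card (nbr H V' u) \<le> q - 2" if u: "u \<in> V'" for u
    proof (cases "u \<in> N")
      case True
      then have v: "v \<in> nbr R V u" using vV R_sym by (auto simp: nbr_def)
      have "card (nbr H V' u) \<le> card (nbr R V u - {v})"
        using finV by (intro card_mono) (auto simp: nbr_def H_def V'_def)
      also have "\<dots> = card (nbr R V u) - 1" using v finV by simp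
      also have "\<dots> \<le> q - 2" using max_deg[of u] u d by (auto simp: V'_def)
      finally show ?thesis .
    next
      case False
      then have "card (nbr H V' u) \<le> card (N - {x})"
        using finN by (intro card_mono) (auto simp: nbr_def H_def V'_def)
      then show ?thesis using xy d finN by simp
    qed
    fix a b a' b'
    assume *: "{a, b, a', b'} \<subseteq> V'" "distinct [a, b, a', b']" "H a b" "H a' b'"
    obtain x1 y1 where 1: "x1 \<in> N" "R x1 y1" "x1 = a \<and> y1 = b \<or> x1 = b \<and> y1 = a"
      using *(3) oriented[of a b] unfolding H_def by blast
    obtain x2 y2 where 2: "x2 \<in> N" "R x2 y2" "x2 = a' \<and> y2 = b' \<or> x2 = b' \<and> y2 = a'"
      using *(4) oriented[of a' b'] unfolding H_def by blast
    have "v \<noteq> x" "v \<noteq> y" "x \<noteq> y" using xy v_notin_N by auto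
    then have "distinct [v, x, x1, x2, y, y1, y2]" "{y, y1, y2} \<subseteq> V"
      using 1(3) 2(3) *(1,2) xy(2) unfolding V'_def by (elim disjE; force)+
    then have "d < q - 3 + 2"
      using 1 2 xy by (intro no_spider[of x x1 x2 y y1 y2 "{y1, y2}"]) (auto simp: card_insert_if)
    then show False using d q9 by linarith
  qed (use finV q9 in \<open>auto simp: V'_def\<close>)
  moreover have "(\<Sum>u\<in>N - {x}. card (nbr H V' u)) \<le> card (arcs H V')"
    unfolding card_arcs[of V' H, OF finite_subset[OF _ finV], unfolded V'_def, OF Diff_subset, folded V'_def]
    using finV xy N_subset v_notin_N by (intro sum_mono2) (auto simp: V'_def)
  moreover have "(\<Sum>u\<in>N - {x}. card (nbr R V u)) \<le> (\<Sum>u\<in>N - {x}. 3 + card (nbr H V' u))"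
  proof (rule sum_mono)
    fix u assume u: "u \<in> N - {x}"
    have "card (nbr R V u) \<le> card ({v, x, y} \<union> nbr H V' u)"
      using u finV by (intro card_mono) (auto simp: nbr_def H_def V'_def)
    also have "\<dots> \<le> card {v, x, y} + card (nbr H V' u)" by (rule card_Un_le)
    also have "card {v, x, y} \<le> 3" by (simp add: card_insert_if)
    finally show "card (nbr R V u) \<le> 3 + card (nbr H V' u)" by simp
  qed
  moreover have cN: "card (N - {x}) = q - 2" using xy d finN by simp
  \<comment> \<open>Each of the \<open>q - 2\<close> vertices has at most three neighbours among
    \<open>v\<close>, \<open>x\<close>, \<open>y\<close>, and their degrees under \<open>H\<close>
    add up to at most \<open>2 * (q - 2)\<close>.\<close>
  ultimately have "(\<Sum>u\<in>N - {x}. card (nbr R V u)) \<le> 5 * (q - 2)"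
    by (simp add: sum.distrib)
  then have "card (arcs R V) \<le> 5 * (q - 2) + d * (card V - card (N - {x}))"
    using N_subset by (intro card_arcs_le_subset) auto
  moreover have "psi q (card V) + 5 * (q - 2) \<le> (q - 1) * (q - 2)"
  proof -
    obtain i where i: "q = 9 + i" using q9 le_Suc_ex by blast
    have "q * q + 20 * (q - 2) \<le> 4 * ((q - 1) * (q - 2))"
      unfolding i by (simp add: algebra_simps)
    then show ?thesis using four_psi_le by linarith
  qed
  moreover have "(q - 1) * card V = (q - 1) * (card V - (q - 2)) + (q - 1) * (q - 2)"
    using q_less by (simp flip: distrib_left)
  ultimately show ?thesis unfolding cN d by linarith
qed

text \<open>Two disjoint edges from \<open>N\<close> to \<open>W\<close> are two legs with feet
  outside \<open>N\<close>. Any other vertex of \<open>N\<close> with a neighbour besides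
  \<open>v\<close> and the leg vertices would supply the third leg, so its degree is at most 5.
  Otherwise one vertex covers all edges between \<open>N\<close> and \<open>W\<close>, and the cut
  applies.\<close>

lemma bound_degree_q_minus_2:
  assumes d: "d = q - 2"
  shows "card (arcs R V) + psi q (card V) \<le> (q - 1) * card V"
proof (cases "\<exists>x1\<in>N. \<exists>y1\<in>W. \<exists>x2\<in>N. \<exists>y2\<in>W. R x1 y1 \<and> R x2 y2 \<and> x1 \<noteq> x2 \<and> y1 \<noteq> y2")
  case True
  then obtain x1 y1 x2 y2 where m: "x1 \<in> N" "y1 \<in> W" "x2 \<in> N" "y2 \<in> W" "R x1 y1" "R x2 y2"
    "x1 \<noteq> x2" "y1 \<noteq> y2" by blast
  define M where "M = N - {x1, x2}"
  have cM: "card M = q - 4" using m d finN by (simp add: M_def card_Diff_subset)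
  have "card (nbr R V u) \<le> 5" if u: "u \<in> M" for u
  proof -
    have "nbr R V u \<subseteq> {v, x1, x2, y1, y2}"
    proof
      fix z assume z: "z \<in> nbr R V u"
      show "z \<in> {v, x1, x2, y1, y2}"
      proof (rule ccontr)
        assume nz: "z \<notin> {v, x1, x2, y1, y2}"
        have "u \<noteq> z" using z R_irrefl by (auto simp: nbr_def)
        then have "distinct [v, x1, x2, u, y1, y2, z]"
          using u m nz v_notin_N unfolding M_def by auto
        then have "d < q - 3 + 1"
          using u m z by (intro no_spider[of x1 x2 u y1 y2 z "{z}"]) (auto simp: M_def nbr_def)
        then show False using d q9 by linarith
      qed
    qed
    then have "card (nbr R V u) \<le> card {v, x1, x2, y1, y2}" by (intro card_mono) auto
    also have "\<dots> \<le> 5" by (simp add: card_insert_if)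
    finally show ?thesis .
  qed
  then have "(\<Sum>u\<in>M. card (nbr R V u)) \<le> 5 * (q - 4)"
    using sum_bounded_above[of M "\<lambda>u. card (nbr R V u)" 5] cM by simp
  then have *: "card (arcs R V) \<le> 5 * (q - 4) + d * (card V - card M)"
    using N_subset by (intro card_arcs_le_subset) (auto simp: M_def)
  obtain i where i: "q = 9 + i" using q9 le_Suc_ex by blast
  obtain t where t: "card V = (5 + i) + (5 + t)"
  proof -
    have "(5 + i) + 5 \<le> card V" using q_less i by simp
    then obtain t where "card V = (5 + i) + 5 + t" using le_Suc_ex by blast
    then show ?thesis using that[of t] by simp
  qed
  \<comment> \<open>Rounding \<open>81 / 4\<close> down to 20 matters: with this value the
    comparison at the end is an equality for \<open>t = 0\<close>.\<close>
  have "psi q (card V) \<le> 20 + 8 * i + i * i"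
  proof -
    have "4 * psi q (card V) \<le> 81 + 18 * i + i * i"
      using four_psi_le by (simp add: i algebra_simps)
    moreover have "0 \<le> i * i" by simp
    ultimately show ?thesis by linarith
  qed
  moreover have "card (arcs R V) \<le> 5 * (5 + i) + (7 + i) * (5 + t)"
    using * unfolding cM d t i by simp
  ultimately have "card (arcs R V) + psi q (card V)
      \<le> (5 * (5 + i) + (7 + i) * (5 + t)) + (20 + 8 * i + i * i)"
    by (intro add_mono)
  also have "\<dots> \<le> (8 + i) * ((5 + i) + (5 + t))" by (simp add: algebra_simps)
  also have "\<dots> = (q - 1) * card V" unfolding t i by simp
  finally show ?thesis .
next
  case False
  define P where "P = (\<lambda>x y. x \<in> N \<and> y \<in> W \<and> R x y)"
  obtain X Y where XY: "X \<subseteq> N" "Y \<subseteq> W" "finite X" "finite Y" "card X + card Y \<le> 1"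
    "\<And>x y. P x y \<Longrightarrow> x \<in> X \<or> y \<in> Y"
  proof (rule two_disjoint_or_cover)
    show "x \<in> N \<and> y \<in> W" if "P x y" for x y using that by (simp add: P_def)
    show "False" if "P x y" "P x' y'" "x \<noteq> x'" "y \<noteq> y'" for x y x' y'
      using False that unfolding P_def by blast
  qed (rule that; (assumption | blast))+
  have cA: "card (insert v N - X) = q - 1 - card X"
    using XY d q9 finN v_notin_N by (subst card_Diff_subset) auto
  have cC: "card (X \<union> Y) = card X + card Y"
    using XY by (intro card_Un_disjoint) auto
  have "card X \<le> 1" "card Y \<le> 1" "card X = 0 \<or> card Y = 0" using XY(5) by auto
  show ?thesis
  proof (rule bound_by_cut)
    show "V = (insert v N - X) \<union> (W - Y) \<union> (X \<union> Y)"
      using XY N_subset vV by auto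
    show "insert v N - X \<noteq> {}" using XY v_notin_N by auto
    show "\<not> R a b" if "a \<in> insert v N - X" "b \<in> W - Y" for a b
      using XY(6)[of a b] that by (auto simp: nbr_def P_def)
    \<comment> \<open>A cover vertex in \<open>N\<close> is already among the \<open>q - 1\<close>
      vertices of \<open>insert v N\<close>; one in \<open>W\<close> raises their number to
      \<open>q\<close>.\<close>
    show "q - 1 + card Y = card (insert v N - X) + card (X \<union> Y)"
      using cA cC XY(5) q9 by simp
    obtain i where i: "q = 9 + i" using q9 le_Suc_ex by blast
    consider "card X = 0" "card Y = 0" | "card X = 1" "card Y = 0" | "card X = 0" "card Y = 1"
      using XY(5) by linarith
    then show "card (insert v N - X) * (card (insert v N - X) - 1) + 2 * (card (X \<union> Y) * d)
      \<le> (q - 1 + card Y) * (q - 1 + card Y - 1)"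
      unfolding cA cC d i by cases (simp_all add: algebra_simps)
  qed (use XY q9 in auto)
qed

text \<open>Edges from \<open>N\<close> to \<open>W\<close> have their feet outside
  \<open>N\<close>, so three disjoint ones already give a spider and at most two vertices cover
  them. The comparison with a clique on \<open>q - 2 + card Y\<close> vertices fails only for two
  cover vertices inside \<open>N\<close>, by 2 arcs.\<close>

lemma bound_degree_q_minus_3:
  assumes d: "d = q - 3"
  shows "card (arcs R V) + psi q (card V) \<le> (q - 1) * card V"
proof -
  define P where "P = (\<lambda>x y. x \<in> N \<and> y \<in> W \<and> R x y)"
  have free3: "False" if m: "P x1 y1" "P x2 y2" "P x3 y3" "distinct [x1, x2, x3]" "distinct [y1, y2, y3]"
    for x1 y1 x2 y2 x3 y3
  proof -
    have "distinct [v, x1, x2, x3, y1, y2, y3]"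
      using m v_notin_N unfolding P_def by auto
    then have "d < q - 3 + 0"
      using m by (intro no_spider[of x1 x2 x3 y1 y2 y3 "{}"]) (auto simp: P_def)
    then show False using d by linarith
  qed
  obtain X Y where XY: "X \<subseteq> N" "Y \<subseteq> W" "finite X" "finite Y" "card X + card Y \<le> 2"
    "\<And>x y. P x y \<Longrightarrow> x \<in> X \<or> y \<in> Y"
  proof (rule three_disjoint_or_cover)
    show "x \<in> N \<and> y \<in> W" if "P x y" for x y using that by (simp add: P_def)
  qed ((rule free3; assumption) | (rule that; (assumption | blast)))+
  have cA: "card (insert v N - X) = q - 2 - card X"
    using XY d q9 finN v_notin_N by (subst card_Diff_subset) auto
  have cC: "card (X \<union> Y) = card X + card Y"
    using XY by (intro card_Un_disjoint) auto
  have part: "V = (insert v N - X) \<union> (W - Y) \<union> (X \<union> Y)"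
    using XY N_subset vV by auto
  have sep: "\<not> R a b" if "a \<in> insert v N - X" "b \<in> W - Y" for a b
    using XY(6)[of a b] that by (auto simp: nbr_def P_def)
  obtain i where i: "q = 9 + i" using q9 le_Suc_ex by blast
  show ?thesis
  proof (cases "card X = 2")
    case False
    show ?thesis
    proof (rule bound_by_cut[OF part _ _ _ _ sep])
      show "insert v N - X \<noteq> {}" using XY v_notin_N by auto
      show "q - 2 + card Y = card (insert v N - X) + card (X \<union> Y)"
        using cA cC XY(5) q9 by simp
      consider "card X = 0" "card Y = 0" | "card X = 1" "card Y = 0" | "card X = 0" "card Y = 1"
        | "card X = 1" "card Y = 1" | "card X = 0" "card Y = 2"
        using XY(5) False by linarith
      then show "card (insert v N - X) * (card (insert v N - X) - 1) + 2 * (card (X \<union> Y) * d)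
        \<le> (q - 2 + card Y) * (q - 2 + card Y - 1)"
        unfolding cA cC d i by cases (simp_all add: algebra_simps)
    qed (use XY q9 in auto)
  next
    \<comment> \<open>Two cover vertices inside \<open>N\<close> may save one edge over the clique, so the cut must gain that edge elsewhere.\<close>
    case X2: True
    show ?thesis
    proof (cases "card V mod q + 2 < q")
      case True
      have Y0: "Y = {}" using XY X2 by auto
      have "card (arcs R V) \<le> card (arcs R (insert v N - X)) + card (arcs R W)
          + 2 * (\<Sum>c\<in>X. card (nbr R V c))"
        using finV symR part sep XY unfolding Y0 by (intro card_arcs_le_split) auto
      moreover have "(\<Sum>c\<in>X. card (nbr R V c)) \<le> 2 * (6 + i)"
      proof -
        have "card (nbr R V c) \<le> d" if "c \<in> X" for c using max_deg XY(1) N_subset that by blast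
        then have "(\<Sum>c\<in>X. card (nbr R V c)) \<le> of_nat (card X) * d" by (rule sum_bounded_above)
        then show ?thesis unfolding X2 d i by simp
      qed
      moreover have "card (arcs R (insert v N - X)) \<le> (5 + i) * (4 + i)"
        using card_arcs_le_complete[of "insert v N - X" R] finN irrR cA X2 i by simp
      moreover have "card (arcs R W) + psi q (card W) \<le> (q - 1) * card W"
        by (rule IH) (use vV in auto)
      moreover have "psi q (card V) + 2 \<le> 2 * (7 + i) + psi q (card W)"
      proof -
        have "card W = card V - (q - 2)" using card_V d q9 by simp
        moreover have "psi q (card V) + 2 \<le> 2 * (q - 2) + psi q (card V - (q - 2))"
          using True q_less q9 by (intro psi_add_le_strict) auto
        ultimately show ?thesis by (simp add: i)
      qed
      moreover have "(q - 1) * card V = (q - 1) * card W + (8 + i) * (7 + i)"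
      proof -
        have V: "card V = card W + (7 + i)" using card_V d by (simp add: i)
        show ?thesis unfolding V distrib_left by (simp add: i)
      qed
      moreover have "(5 + i) * (4 + i) + 4 * (6 + i) + 2 * (7 + i) = (8 + i) * (7 + i) + 2"
        by (simp add: algebra_simps)
      ultimately show ?thesis by linarith
    next
      case False
      \<comment> \<open>Here the residue is at least \<open>q - 2\<close>, so the target is at most
        \<open>2 * q\<close> and no cut is made: every vertex has deficiency at least 2, and there
        are more than \<open>q\<close> vertices.\<close>
      have "card (arcs R V) \<le> d * card V"
        using card_arcs_le_subset[of "{}" 0] by simp
      moreover have "psi q (card V) \<le> 2 * q"
        using phi_le_double[of q "card V"] psi_le_phi[of q "card V"] False q9 by linarith
      moreover have "(q - 1) * card V = d * card V + 2 * card V"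
        unfolding d i by (simp add: algebra_simps)
      ultimately show ?thesis using q_less by linarith
    qed
  qed
qed

text \<open>Since \<open>card V\<close> exceeds \<open>q\<close>, it is at least
  \<open>q + card V mod q\<close>, so a deficiency of 3 per vertex reaches the second term of
  \<open>psi\<close>.\<close>

lemma bound_small_degree:
  assumes "d \<le> q - 4"
  shows "card (arcs R V) + psi q (card V) \<le> (q - 1) * card V"
proof -
  have "card (arcs R V) \<le> d * card V"
    using card_arcs_le_subset[of "{}" 0] by simp
  moreover have "d * card V \<le> (q - 4) * card V" using assms by (rule mult_le_mono1)
  moreover have "psi q (card V) \<le> 3 * (q + card V mod q)"
    using q_less by (simp add: psi_def)
  moreover have "q + card V mod q \<le> card V"
  proof -
    have "card V mod q = (card V - q) mod q" using q_less by (intro le_mod_geq) simp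
    moreover have "(card V - q) mod q \<le> card V - q" by (rule mod_less_eq_dividend)
    ultimately show ?thesis using q_less by linarith
  qed
  ultimately have "card (arcs R V) \<le> (q - 4) * card V" "psi q (card V) \<le> 3 * card V"
    by (blast intro: order_trans mult_le_mono2)+
  then have "card (arcs R V) + psi q (card V) \<le> (q - 4) * card V + 3 * card V"
    by (rule add_mono)
  then show ?thesis using q9 by (simp flip: distrib_right)
qed

lemma bound_step: "card (arcs R V) + psi q (card V) \<le> (q - 1) * card V"
proof -
  consider "d \<le> q - 4" | "d = q - 3" | "d = q - 2" | "d = q - 1" | "q \<le> d" using q9 by linarith
  then show ?thesis
    using bound_small_degree bound_degree_q_minus_3 bound_degree_q_minus_2 bound_degree_q_minus_1
      bound_large_degree by cases
qed

end

lemma spider_free_card_arcs_le: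
  assumes "finite V" "symp R" "irreflp R" "spider_free q R V" "9 \<le> q"
  shows "card (arcs R V) + psi q (card V) \<le> (q - 1) * card V"
  using assms
proof (induction V rule: finite_psubset_induct)
  case (psubset V)
  show ?case
  proof (cases "card V \<le> q")
    case True
    \<comment> \<open>The case \<open>card V = q\<close> is separate because the residue is then 0;
      both sides vanish.\<close>
    have "psi q (card V) \<le> card V * (q - card V)"
      using True psubset.prems(4) psi_le_phi[of q "card V"] by (cases "card V = q") (auto simp: phi_def)
    moreover have "card (arcs R V) \<le> card V * (card V - 1)"
      using psubset by (intro card_arcs_le_complete)
    moreover have "card V * (card V - 1) + card V * (q - card V) = (q - 1) * card V"
      using True by (cases "card V = 0") (auto simp flip: distrib_left)
    ultimately show ?thesis by linarith
  next
    case False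
    then have ne: "V \<noteq> {}" by auto
    let ?f = "\<lambda>u. card (nbr R V u)"
    have "Max (?f ` V) \<in> ?f ` V" using psubset.hyps ne by (intro Max_in) auto
    then obtain v where v: "v \<in> V" "?f v = Max (?f ` V)" by auto
    interpret extremal_step q R V v
    proof
      show "?f u \<le> ?f v" if "u \<in> V" for u using v that psubset.hyps by auto
      show "card (arcs R U) + psi q (card U) \<le> (q - 1) * card U" if "U \<subset> V" for U
        using that psubset by (intro psubset.IH) (auto intro: spider_free_subset)
    qed (use psubset False v in auto)
    show ?thesis by (rule bound_step)
  qed
qed

section \<open>Translation to edge sets\<close>

lemma T3_vertex_cases:
  fixes i n :: nat
  assumes "10 \<le> n" "i < n"
  obtains "i = 0" | "i \<in> {1..n - 4}" | "i = n - 3" | "i = n - 2" | "i = n - 1"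
proof -
  consider "i = 0" | "1 \<le> i" "i \<le> n - 4" | "i = n - 3" | "i = n - 2" | "i = n - 1"
    using assms by linarith
  then show ?thesis by cases (use that in simp_all)
qed

lemma contains_T3_iff:
  assumes "10 \<le> n"
  shows "contains_subgraph V E (T3_vertices n) (T3_edges n) \<longleftrightarrow>
    (\<exists>f. inj_on f {0..<n} \<and> f ` {0..<n} \<subseteq> V \<and> (\<forall>i\<in>{1..n - 4}. {f 0, f i} \<in> E) \<and>
      {f 1, f (n - 3)} \<in> E \<and> {f 2, f (n - 2)} \<in> E \<and> {f 3, f (n - 1)} \<in> E)"
proof -
  have "(\<forall>e\<in>T3_edges n. f ` e \<in> E) \<longleftrightarrow> (\<forall>i\<in>{1..n - 4}. {f 0, f i} \<in> E) \<and>
      {f 1, f (n - 3)} \<in> E \<and> {f 2, f (n - 2)} \<in> E \<and> {f 3, f (n - 1)} \<in> E" for f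
  proof -
    have "T3_edges n = (\<lambda>i. {0, i}) ` {1..n - 4} \<union> {{1, n - 3}, {2, n - 2}, {3, n - 1}}"
    proof -
      have "{i. 1 \<le> i \<and> i \<le> n - 4} = {1..n - 4}" by auto
      then show ?thesis unfolding T3_edges_def setcompr_eq_image by simp
    qed
    then show ?thesis by (auto simp: ball_Un)
  qed
  then show ?thesis
    unfolding contains_subgraph_def T3_vertices_def by simp
qed

lemma spider_free_if_not_contains_T3:
  assumes n: "10 \<le> n" and "finite V" and loopless: "\<And>u. {u} \<notin> E"
    and not: "\<not> contains_subgraph V E (T3_vertices n) (T3_edges n)"
  shows "spider_free (n - 1) (\<lambda>u w. {u, w} \<in> E) V"
  unfolding spider_free_def
proof (intro allI impI)
  fix v x1 x2 x3 y1 y2 y3 :: nat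
  let ?R = "\<lambda>u w. {u, w} \<in> E"
  let ?F = "{x1, x2, x3, y1, y2, y3}"
  let ?S = "nbr ?R V v - ?F"
  assume *: "{v, x1, x2, x3, y1, y2, y3} \<subseteq> V" "distinct [v, x1, x2, x3, y1, y2, y3]"
    and e: "{v, x1} \<in> E" "{v, x2} \<in> E" "{v, x3} \<in> E" "{x1, y1} \<in> E" "{x2, y2} \<in> E" "{x3, y3} \<in> E"
  show "card ?S < n - 1 - 6"
  proof (rule ccontr)
    assume "\<not> ?thesis"
    then have "card {4..n - 4} \<le> card ?S" by simp
    then obtain g where g: "inj_on g {4..n - 4}" "g ` {4..n - 4} \<subseteq> ?S"
      using inj_on_iff_card_le[of "{4..n - 4}" ?S] assms(2) by auto
    \<comment> \<open>\<open>g\<close> supplies the leaves with indices 4 to \<open>n - 4\<close>,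
      which number \<open>n - 7\<close>. Since \<open>10 \<le> n\<close>, the updated arguments are
      distinct and outside that range.\<close>
    define f where "f = g(0 := v, 1 := x1, 2 := x2, 3 := x3, n - 3 := y1, n - 2 := y2, n - 1 := y3)"
    obtain l where l: "n = 10 + l" using n le_Suc_ex by blast
    have f: "f 0 = v" "f 1 = x1" "f (Suc 0) = x1" "f 2 = x2" "f 3 = x3" "f (n - 3) = y1" "f (n - 2) = y2" "f (n - 1) = y3"
      by (simp_all add: f_def l)
    have fg: "f i = g i" if "i \<in> {4..n - 4}" for i
      using that by (simp add: f_def l)
    let ?A = "{0, 1, 2, 3, n - 3, n - 2, n - 1}"
    have dec: "{0..<n} = ?A \<union> {4..n - 4}"
    proof
      show "{0..<n} \<subseteq> ?A \<union> {4..n - 4}"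
      proof
        fix i assume "i \<in> {0..<n}"
        then have "i < n" by simp
        with n show "i \<in> ?A \<union> {4..n - 4}"
        proof (cases rule: T3_vertex_cases)
          case 2
          then consider "i = 1" | "i = 2" | "i = 3" | "i \<in> {4..n - 4}"
            unfolding atLeastAtMost_iff by linarith
          then show ?thesis by cases simp_all
        qed simp_all
      qed
    qed (use n in auto)
    have img: "f ` {4..n - 4} \<subseteq> ?S" using g(2) fg by auto
    have "v \<notin> ?S" using loopless[of v] by (simp add: nbr_def)
    have imgA: "f ` ?A = {v, x1, x2, x3, y1, y2, y3}" using f by simp
    have "inj_on f {4..n - 4}" using g(1) inj_on_cong[of "{4..n - 4}" f g] fg by blast
    moreover have "inj_on f ?A"
    proof (rule eq_card_imp_inj_on)
      have "card ?A = 7" by (simp add: card_insert_if l)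
      then show "card (f ` ?A) = card ?A" unfolding imgA using *(2) by simp
    qed simp
    moreover have "f ` ?A \<inter> f ` {4..n - 4} = {}" unfolding imgA using img \<open>v \<notin> ?S\<close> by auto
    then have "f ` (?A - {4..n - 4}) \<inter> f ` ({4..n - 4} - ?A) = {}"
      by (meson Diff_subset disjoint_iff image_mono subset_iff)
    ultimately have "inj_on f {0..<n}" unfolding dec inj_on_Un by (intro conjI)
    moreover have "f ` {0..<n} \<subseteq> V"
      unfolding dec image_Un imgA using img *(1) by (auto simp: nbr_def)
    moreover have "{f 0, f i} \<in> E" if "i \<in> {1..n - 4}" for i
    proof (cases "i \<in> {4..n - 4}")
      case True
      then have "f i \<in> ?S" using img by blast
      then show ?thesis by (simp add: nbr_def f(1))
    next
      case False
      then have "i = 1 \<or> i = 2 \<or> i = 3" using that by auto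
      then show ?thesis using e f by auto
    qed
    ultimately have "contains_subgraph V E (T3_vertices n) (T3_edges n)"
      unfolding contains_T3_iff[OF n] using e f by (intro exI[of _ f]) simp
    then show False using not by contradiction
  qed
qed

text \<open>Double counting: the fibre over an edge consists of its two orientations, distinct by
  irreflexivity.\<close>

lemma card_arcs_eq_twice:
  assumes "finite V" "E = (\<lambda>(u, w). {u, w}) ` arcs R V" "symp R" "irreflp R"
  shows "card (arcs R V) = 2 * card E"
proof -
  let ?g = "\<lambda>(u, w). {u, w}"
  have "card {a \<in> arcs R V. ?g a = e} = 2" if "e \<in> E" for e
  proof -
    from that assms(2) obtain u w where uw: "(u, w) \<in> arcs R V" "e = {u, w}" by auto
    then have "u \<noteq> w" "(w, u) \<in> arcs R V"
      using assms(3,4) by (auto simp: arcs_def nbr_def irreflp_def dest: sympD)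
    then have "{a \<in> arcs R V. ?g a = e} = {(u, w), (w, u)}"
      using uw by (auto simp: doubleton_eq_iff)
    then show ?thesis using \<open>u \<noteq> w\<close> by simp
  qed
  then have "(\<Sum>e\<in>E. card {a \<in> arcs R V. ?g a = e}) = 2 * card E" by simp
  moreover have "(\<Sum>e\<in>E. \<Sum>a | a \<in> arcs R V \<and> ?g a = e. 1) = (\<Sum>a\<in>arcs R V. 1::nat)"
    by (rule sum.group) (use assms in auto)
  ultimately show ?thesis by simp
qed

lemma simple_graph_card_le:
  assumes "10 \<le> n" "simple_graph V E" "\<not> contains_subgraph V E (T3_vertices n) (T3_edges n)"
  shows "2 * card E + psi (n - 1) (card V) \<le> (n - 2) * card V"
proof -
  let ?R = "\<lambda>u w. {u, w} \<in> E"
  have fin: "finite V" and pair: "\<And>e. e \<in> E \<Longrightarrow> \<exists>u v. u \<noteq> v \<and> u \<in> V \<and> v \<in> V \<and> e = {u, v}"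
    using assms(2) by (auto simp: simple_graph_def)
  have sym: "symp ?R" by (auto intro!: sympI simp: insert_commute)
  have loopless: "{u} \<notin> E" for u using pair[of "{u}"] by auto
  then have irr: "irreflp ?R" by (simp add: irreflp_def)
  have "E = (\<lambda>(u, w). {u, w}) ` arcs ?R V"
  proof
    show "E \<subseteq> (\<lambda>(u, w). {u, w}) ` arcs ?R V"
    proof
      fix e assume "e \<in> E"
      then obtain u w where "u \<in> V" "w \<in> V" "e = {u, w}" using pair by blast
      then show "e \<in> (\<lambda>(u, w). {u, w}) ` arcs ?R V"
        using \<open>e \<in> E\<close> by (intro image_eqI[of _ _ "(u, w)"]) (auto simp: arcs_def nbr_def)
    qed
  qed (auto simp: arcs_def nbr_def)
  then have "card (arcs ?R V) = 2 * card E"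
    using fin sym irr by (intro card_arcs_eq_twice)
  moreover have "card (arcs ?R V) + psi (n - 1) (card V) \<le> (n - 1 - 1) * card V"
    using assms fin sym irr by (intro spider_free_card_arcs_le spider_free_if_not_contains_T3 loopless) auto
  moreover have "n - 1 - 1 = n - 2" by simp
  ultimately show ?thesis by metis
qed

section \<open>The extremal graphs\<close>

text \<open>A circulant graph with the cyclic distances \<open>2, \<dots>, h\<close>. Distance 1 is left out so that, for odd \<open>d\<close>, the
  matching of \<open>2 i\<close> with \<open>2 i + 1\<close> can be added even when \<open>m\<close> is odd.\<close>

lemma near_regular_graph_exists:
  fixes m d :: nat
  assumes "d + 2 < m"
  obtains H :: "nat \<Rightarrow> nat \<Rightarrow> bool" where "symp H" "irreflp H"
    "\<And>u. u < m \<Longrightarrow> card (nbr H {0..<m} u) \<le> d" "m * d \<le> card (arcs H {0..<m}) + 1"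
proof -
  define h where "h = d div 2 + 1"
  \<comment> \<open>\<open>T\<close> is invariant under replacing \<open>t\<close> by
    \<open>m - t\<close> and has \<open>d div 2\<close> elements in each half;
    \<open>2 * h < m\<close> keeps the halves disjoint.\<close>
  define T where "T = {2..h} \<union> {m - h..m - 2}"
  \<comment> \<open>By truncated subtraction one summand is 0, so the sum is the absolute
    difference.\<close>
  define D where "D = (\<lambda>u w::nat. (w - u) + (u - w) \<in> T)"
  define M where "M = (\<lambda>u w::nat. odd d \<and> u div 2 = w div 2 \<and> u \<noteq> w)"
  define H where "H = (\<lambda>u w. D u w \<or> M u w)"
  have h: "2 * h < m" "1 \<le> h" using assms by (auto simp: h_def)
  have T0: "0 \<notin> T" "1 \<notin> T" using h by (auto simp: T_def)
  have Tsym: "m - t \<in> T" if "t \<in> T" for t using that h by (auto simp: T_def)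
  have T_less: "t < m" if "t \<in> T" for t using that h by (auto simp: T_def)
  have cT: "card T = 2 * (d div 2)"
  proof -
    have "card T = card {2..h} + card {m - h..m - 2}"
      unfolding T_def using h by (intro card_Un_disjoint) auto
    then show ?thesis using h by (simp add: h_def)
  qed
  have cD: "card (nbr D {0..<m} u) = 2 * (d div 2)" if u: "u < m" for u
  proof -
    have "bij_betw (\<lambda>w. if u \<le> w then w - u else w + m - u) (nbr D {0..<m} u) T"
    proof (rule bij_betw_byWitness[where f' = "\<lambda>t. if u + t < m then u + t else u + t - m"])
      show "(\<lambda>w. if u \<le> w then w - u else w + m - u) ` nbr D {0..<m} u \<subseteq> T"
      proof (rule image_subsetI)
        fix w assume w: "w \<in> nbr D {0..<m} u"
        show "(if u \<le> w then w - u else w + m - u) \<in> T"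
        proof (cases "u \<le> w")
          case False
          then have "m - (u - w) \<in> T" using w by (intro Tsym) (auto simp: nbr_def D_def)
          moreover have "m - (u - w) = w + m - u" using False u by simp
          ultimately show ?thesis using False by simp
        qed (use w in \<open>auto simp: nbr_def D_def\<close>)
      qed
      show "(\<lambda>t. if u + t < m then u + t else u + t - m) ` T \<subseteq> nbr D {0..<m} u"
      proof (rule image_subsetI)
        fix t assume t: "t \<in> T"
        then have "t < m" "m - t \<in> T" using T_less Tsym by auto
        moreover have "u - (u + t - m) = m - t" "u + t - m < m" if "m \<le> u + t"
          using that u \<open>t < m\<close> by auto
        ultimately show "(if u + t < m then u + t else u + t - m) \<in> nbr D {0..<m} u"
          using t by (auto simp: nbr_def D_def)
      qed
    qed (use u in \<open>auto simp: nbr_def dest!: T_less\<close>)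
    then show ?thesis using cT by (simp add: bij_betw_same_card)
  qed
  have cM: "card (nbr M {0..<m} u) \<le> d mod 2"
    "u + 1 \<noteq> m \<Longrightarrow> card (nbr M {0..<m} u) = d mod 2" if u: "u < m" for u
  proof -
    define w where "w = (if even u then u + 1 else u - 1)"
    have w: "u div 2 = x div 2 \<and> u \<noteq> x \<longleftrightarrow> x = w" for x
      unfolding w_def by (auto; presburger)
    have nb: "nbr M {0..<m} u = (if odd d \<and> w < m then {w} else {})"
      unfolding nbr_def M_def using w by auto
    show "card (nbr M {0..<m} u) \<le> d mod 2"
      unfolding nb by (auto simp: odd_iff_mod_2_eq_one)
    show "card (nbr M {0..<m} u) = d mod 2" if "u + 1 \<noteq> m"
    proof -
      have "w < m" using u that by (auto simp: w_def)
      then show ?thesis unfolding nb by (auto simp: odd_iff_mod_2_eq_one)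
    qed
  qed
  have nbrH: "card (nbr H {0..<m} u) = 2 * (d div 2) + card (nbr M {0..<m} u)" if "u < m" for u
  proof -
    have "\<not> D u w" if "M u w" for w
    proof -
      have "(w - u) + (u - w) = 1" using that unfolding M_def by presburger
      then show ?thesis using T0 by (simp add: D_def)
    qed
    then have "nbr D {0..<m} u \<inter> nbr M {0..<m} u = {}" by (auto simp: nbr_def)
    moreover have "nbr H {0..<m} u = nbr D {0..<m} u \<union> nbr M {0..<m} u"
      by (auto simp: nbr_def H_def)
    ultimately show ?thesis using cD[OF that] by (simp add: card_Un_disjoint)
  qed
  have "symp H" by (auto intro!: sympI simp: H_def D_def M_def add.commute)
  moreover have "irreflp H" using T0 by (auto simp: irreflp_def H_def D_def M_def)
  moreover have "card (nbr H {0..<m} u) \<le> d" if "u < m" for u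
    using nbrH[OF that] cM(1)[OF that] mult_div_mod_eq[of 2 d] by linarith
  moreover have "m * d \<le> card (arcs H {0..<m}) + 1"
  proof -
    \<comment> \<open>Only the vertex \<open>m - 1\<close> may lack a partner in the added matching;
      this is the one arc lost in the statement.\<close>
    have "d \<le> card (nbr H {0..<m} u) + (if u = m - 1 then 1 else 0)" if "u < m" for u
      using nbrH[OF that] cM(2)[OF that] mult_div_mod_eq[of 2 d] by auto
    then have "(\<Sum>u\<in>{0..<m}. d) \<le> (\<Sum>u\<in>{0..<m}. card (nbr H {0..<m} u) + (if u = m - 1 then 1 else 0))"
      by (intro sum_mono) simp
    also have "\<dots> = card (arcs H {0..<m}) + 1"
      unfolding sum.distrib card_arcs[OF finite_atLeastLessThan] using assms by (simp add: sum.delta)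
    finally show ?thesis by simp
  qed
  ultimately show ?thesis by (rule that)
qed

text \<open>One definition serves both constructions: \<open>b = p\<close> gives disjoint cliques
  with a truncated last one, and \<open>b\<close> a multiple of \<open>q\<close> gives full cliques
  next to the nearly regular graph \<open>H\<close>.\<close>

definition block_graph :: "nat \<Rightarrow> nat \<Rightarrow> (nat \<Rightarrow> nat \<Rightarrow> bool) \<Rightarrow> nat \<Rightarrow> nat \<Rightarrow> bool" where
  "block_graph q b H u w \<longleftrightarrow> u < b \<and> w < b \<and> u div q = w div q \<and> u \<noteq> w
     \<or> b \<le> u \<and> b \<le> w \<and> H (u - b) (w - b)"

lemma block_graph_below:
  "block_graph q b H u w \<Longrightarrow> u < b \<Longrightarrow> w < b \<and> w div q = u div q"
  by (auto simp: block_graph_def)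

text \<open>A centre below \<open>b\<close> would trap all \<open>n\<close> tree vertices in a block
  of \<open>n - 1\<close> numbers; a centre from \<open>b\<close> on would need degree
  \<open>n - 4\<close> in \<open>H\<close>.\<close>

lemma block_graph_free:
  assumes n: "10 \<le> n" and bp: "b \<le> p"
    and deg: "\<And>u. u < p - b \<Longrightarrow> card (nbr H {0..<p - b} u) \<le> n - 5"
    and E: "\<And>u w. {u, w} \<in> E \<Longrightarrow> block_graph (n - 1) b H u w"
  shows "\<not> contains_subgraph {0..<p} E (T3_vertices n) (T3_edges n)"
proof
  assume "contains_subgraph {0..<p} E (T3_vertices n) (T3_edges n)"
  then obtain f where inj: "inj_on f {0..<n}" and f: "f ` {0..<n} \<subseteq> {0..<p}"
    and nb: "\<And>i. i \<in> {1..n - 4} \<Longrightarrow> block_graph (n - 1) b H (f 0) (f i)"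
    and legs: "block_graph (n - 1) b H (f 1) (f (n - 3))" "block_graph (n - 1) b H (f 2) (f (n - 2))"
      "block_graph (n - 1) b H (f 3) (f (n - 1))"
    unfolding contains_T3_iff[OF n] using E by blast
  show False
  proof (cases "f 0 < b")
    case True
    define c where "c = f 0 div (n - 1)"
    have 1: "f i < b \<and> f i div (n - 1) = c" if "i \<in> {1..n - 4}" for i
      using nb[OF that] True by (auto simp: block_graph_def c_def)
    have f123: "f 1 < b \<and> f 1 div (n - 1) = c" "f 2 < b \<and> f 2 div (n - 1) = c" "f 3 < b \<and> f 3 div (n - 1) = c"
      by (rule 1; use n in simp)+
    have 2: "f (n - 3) div (n - 1) = c" "f (n - 2) div (n - 1) = c" "f (n - 1) div (n - 1) = c"
      using block_graph_below[OF legs(1)] block_graph_below[OF legs(2)] block_graph_below[OF legs(3)] f123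
      by simp_all
    have 3: "f i div (n - 1) = c" if "i < n" for i
    proof -
      show ?thesis
        using n that by (cases rule: T3_vertex_cases) (use 1 2 in \<open>simp_all add: c_def\<close>)
    qed
    have "f ` {0..<n} \<subseteq> {c * (n - 1)..<c * (n - 1) + (n - 1)}"
    proof (rule image_subsetI)
      fix i assume "i \<in> {0..<n}"
      then have "c * (n - 1) + f i mod (n - 1) = f i"
        using 3[of i] div_mult_mod_eq[of "f i" "n - 1"] by simp
      moreover have "f i mod (n - 1) < n - 1" using n by simp
      ultimately show "f i \<in> {c * (n - 1)..<c * (n - 1) + (n - 1)}"
        unfolding atLeastLessThan_iff by linarith
    qed
    then have "card (f ` {0..<n}) \<le> card {c * (n - 1)..<c * (n - 1) + (n - 1)}"
      by (intro card_mono) auto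
    then show False using inj n by (simp add: card_image)
  next
    case False
    let ?g = "\<lambda>i. f i - b"
    have 1: "b \<le> f i \<and> H (f 0 - b) (f i - b)" if "i \<in> {1..n - 4}" for i
      using nb[OF that] False by (auto simp: block_graph_def)
    have 2: "f i < p" if "i < n" for i using f that by (simp add: image_subset_iff)
    have "?g ` {1..n - 4} \<subseteq> nbr H {0..<p - b} (f 0 - b)"
    proof (rule image_subsetI)
      fix i assume i: "i \<in> {1..n - 4}"
      then have "i < n" by auto
      then have "f i - b < p - b" using 1[OF i] 2[of i] by linarith
      then show "f i - b \<in> nbr H {0..<p - b} (f 0 - b)" using 1[OF i] by (simp add: nbr_def)
    qed
    then have "card (?g ` {1..n - 4}) \<le> card (nbr H {0..<p - b} (f 0 - b))"
      by (intro card_mono) auto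
    moreover have "inj_on ?g {1..n - 4}"
    proof (rule inj_onI)
      fix i j assume ij: "i \<in> {1..n - 4}" "j \<in> {1..n - 4}" "f i - b = f j - b"
      then have "f i = f j" using 1[OF ij(1)] 1[OF ij(2)] by linarith
      moreover have "i \<in> {0..<n}" "j \<in> {0..<n}" using ij by auto
      ultimately show "i = j" using inj by (meson inj_onD)
    qed
    ultimately show False
    proof -
      assume "card (?g ` {1..n - 4}) \<le> card (nbr H {0..<p - b} (f 0 - b))" "inj_on ?g {1..n - 4}"
      then have "n - 4 \<le> card (nbr H {0..<p - b} (f 0 - b))" by (simp add: card_image)
      moreover have "f 0 - b < p - b" using 2[of 0] False n by linarith
      ultimately show False using deg[of "f 0 - b"] n by linarith
    qed
  qed
qed

lemma finite_T3_free_cards: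
  "finite {card E | E. simple_graph {0..<p} E \<and> \<not> contains_subgraph {0..<p} E VL EL}"
proof (rule finite_subset)
  show "{card E | E. simple_graph {0..<p} E \<and> \<not> contains_subgraph {0..<p} E VL EL}
    \<subseteq> card ` Pow (Pow {0..<p})"
  proof clarify
    fix E assume "simple_graph {0..<p} E"
    then have "E \<in> Pow (Pow {0..<p})" by (auto simp: simple_graph_def)
    then show "card E \<in> card ` Pow (Pow {0..<p})" by (rule imageI)
  qed
qed simp

lemma block_graph_card_le_ex:
  assumes n: "10 \<le> n" and bp: "b \<le> p" and H: "symp H" "irreflp H"
    and deg: "\<And>u. u < p - b \<Longrightarrow> card (nbr H {0..<p - b} u) \<le> n - 5"
  shows "card (arcs (block_graph (n - 1) b H) {0..<p}) \<le> 2 * ex p (T3_vertices n) (T3_edges n)"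
proof -
  let ?R = "block_graph (n - 1) b H"
  define E where "E = (\<lambda>(u, w). {u, w}) ` arcs ?R {0..<p}"
  have sym: "symp ?R" using H(1) by (auto intro!: sympI simp: block_graph_def dest: sympD)
  have irr: "irreflp ?R" using H(2) by (auto simp: irreflp_def block_graph_def)
  have "simple_graph {0..<p} E"
    unfolding simple_graph_def
  proof (intro conjI ballI)
    fix e assume "e \<in> E"
    then obtain u w where "u < p" "w < p" "?R u w" "e = {u, w}"
      by (auto simp: E_def arcs_def nbr_def)
    moreover from this have "u \<noteq> w" using irr by (auto simp: irreflp_def)
    ultimately show "\<exists>u v. u \<noteq> v \<and> u \<in> {0..<p} \<and> v \<in> {0..<p} \<and> e = {u, v}" by auto
  qed simp
  moreover have "\<not> contains_subgraph {0..<p} E (T3_vertices n) (T3_edges n)"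
  proof (rule block_graph_free[OF n bp deg])
    show "?R u w" if "{u, w} \<in> E" for u w
      using that sym by (auto simp: E_def arcs_def nbr_def doubleton_eq_iff dest: sympD)
  qed
  ultimately have "card E \<le> ex p (T3_vertices n) (T3_edges n)"
    unfolding ex_def by (intro Max_ge finite_T3_free_cards) auto
  moreover have "card (arcs ?R {0..<p}) = 2 * card E"
    using E_def sym irr by (intro card_arcs_eq_twice) auto
  ultimately show ?thesis by simp
qed

lemma card_nbr_block_ge:
  assumes "0 < q" "u < k * q" "k * q \<le> b" "b \<le> p"
  shows "q - 1 \<le> card (nbr (block_graph q b H) {0..<p} u)"
proof -
  define c where "c = u div q"
  have "c < k" using assms by (simp add: c_def div_less_iff_less_mult)
  then have "c * q + q \<le> b" using assms(3) mult_le_mono1[of "Suc c" k q] by simp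
  moreover have "u \<in> {c * q..<c * q + q}"
  proof -
    have "c * q + u mod q = u" "u mod q < q"
      using assms(1) div_mult_mod_eq[of u q] by (auto simp: c_def)
    then show ?thesis unfolding atLeastLessThan_iff by linarith
  qed
  moreover have "w div q = c" if "w \<in> {c * q..<c * q + q}" for w
    using that by (intro div_nat_eqI) (auto simp: mult.commute[of c])
  ultimately have "{c * q..<c * q + q} - {u} \<subseteq> nbr (block_graph q b H) {0..<p} u"
    using assms(4) unfolding nbr_def block_graph_def by fastforce
  then have "card ({c * q..<c * q + q} - {u}) \<le> card (nbr (block_graph q b H) {0..<p} u)"
    by (intro card_mono) auto
  then show ?thesis using \<open>u \<in> {c * q..<c * q + q}\<close> by simp
qed

lemma card_arcs_block_ge:
  assumes "0 < q" "k * q \<le> b" "b \<le> p"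
    and rest: "s \<le> (\<Sum>u\<in>{k * q..<p}. card (nbr (block_graph q b H) {0..<p} u))"
  shows "k * q * (q - 1) + s \<le> card (arcs (block_graph q b H) {0..<p})"
proof -
  let ?f = "\<lambda>u. card (nbr (block_graph q b H) {0..<p} u)"
  have "(\<Sum>u\<in>{0..<k * q}. q - 1) \<le> sum ?f {0..<k * q}"
    using assms by (intro sum_mono card_nbr_block_ge) auto
  moreover have "sum ?f {0..<p} = sum ?f {0..<k * q} + sum ?f {k * q..<p}"
    using assms by (intro sum.atLeastLessThan_concat[symmetric]) auto
  ultimately show ?thesis using rest by (simp add: card_arcs)
qed

lemma ex_ge_cliques:
  assumes n: "10 \<le> n" and r: "r < n - 1" and p: "p = k * (n - 1) + r"
  shows "k * (n - 1) * (n - 2) + r * (r - 1) \<le> 2 * ex p (T3_vertices n) (T3_edges n)"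
proof -
  \<comment> \<open>Taking \<open>p\<close> for \<open>b\<close> leaves the part carrying
    \<open>H\<close> empty; the block truncated at \<open>p\<close> is the clique on
    \<open>r\<close> vertices.\<close>
  let ?q = "n - 1" and ?R = "block_graph (n - 1) p (\<lambda>_ _. False)"
  have "r - 1 \<le> card (nbr ?R {0..<p} u)" if u: "u \<in> {k * ?q..<p}" for u
  proof -
    have "w div ?q = k" if "w \<in> {k * ?q..<p}" for w
      using that r p by (intro div_nat_eqI) (auto simp: mult.commute[of k])
    then have "{k * ?q..<p} - {u} \<subseteq> nbr ?R {0..<p} u"
      using u by (auto simp: nbr_def block_graph_def)
    then have "card ({k * ?q..<p} - {u}) \<le> card (nbr ?R {0..<p} u)" by (intro card_mono) auto
    then show ?thesis using u p by simp
  qed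
  then have "(\<Sum>u\<in>{k * ?q..<p}. r - 1) \<le> (\<Sum>u\<in>{k * ?q..<p}. card (nbr ?R {0..<p} u))"
    by (rule sum_mono)
  then have "r * (r - 1) \<le> (\<Sum>u\<in>{k * ?q..<p}. card (nbr ?R {0..<p} u))" using p by simp
  then have "k * ?q * (?q - 1) + r * (r - 1) \<le> card (arcs ?R {0..<p})"
    using n p by (intro card_arcs_block_ge) auto
  also have "\<dots> \<le> 2 * ex p (T3_vertices n) (T3_edges n)"
    using n by (intro block_graph_card_le_ex) (auto simp: symp_def irreflp_def)
  finally show ?thesis by (simp add: numeral_2_eq_2)
qed

lemma ex_ge_near_regular:
  assumes n: "10 \<le> n" and p: "p = k * (n - 1) + m" and m: "n - 1 \<le> m"
  shows "k * (n - 1) * (n - 2) + m * (n - 5) \<le> 2 * ex p (T3_vertices n) (T3_edges n) + 1"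
proof -
  let ?q = "n - 1" and ?b = "k * (n - 1)"
  obtain H where H: "symp H" "irreflp H" "\<And>u. u < m \<Longrightarrow> card (nbr H {0..<m} u) \<le> n - 5"
    "m * (n - 5) \<le> card (arcs H {0..<m}) + 1"
  proof (rule near_regular_graph_exists)
    show "n - 5 + 2 < m" using n m by linarith
  qed (rule that; assumption)
  let ?R = "block_graph ?q ?b H"
  have "(\<Sum>u\<in>{0..<m}. card (nbr H {0..<m} u)) \<le> (\<Sum>u\<in>{0..<m}. card (nbr ?R {0..<p} (u + ?b)))"
  proof (rule sum_mono)
    fix u
    have "card (nbr H {0..<m} u) = card ((\<lambda>w. w + ?b) ` nbr H {0..<m} u)"
      by (simp add: card_image)
    also have "\<dots> \<le> card (nbr ?R {0..<p} (u + ?b))"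
      using p by (intro card_mono) (auto simp: nbr_def block_graph_def)
    finally show "card (nbr H {0..<m} u) \<le> card (nbr ?R {0..<p} (u + ?b))" .
  qed
  also have "\<dots> = (\<Sum>u\<in>{?b..<p}. card (nbr ?R {0..<p} u))"
    using sum.shift_bounds_nat_ivl[of "\<lambda>u. card (nbr ?R {0..<p} u)" 0 ?b m] p by (simp add: add.commute)
  finally have "?b * (?q - 1) + card (arcs H {0..<m}) \<le> card (arcs ?R {0..<p})"
    using n p by (intro card_arcs_block_ge) (auto simp: card_arcs)
  also have "\<dots> \<le> 2 * ex p (T3_vertices n) (T3_edges n)"
    using n p H by (intro block_graph_card_le_ex) auto
  finally show ?thesis using H(4) by (simp add: numeral_2_eq_2)
qed

section \<open>Matching the bounds and rounding\<close>

theorem theorem5p1: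
  fixes p n k r :: nat
  assumes "10 \<le> n" and "n \<le> p"
    and "1 \<le> k" and "r \<le> n - 2" and "p = k * (n - 1) + r"
  shows "real (ex p (T3_vertices n) (T3_edges n)) =
           ((real n - 2) * real p - real r * (real n - 1 - real r)) / 2
           + real_of_int (max 0 \<lfloor>(real r * (real n - 4 - real r) - 3 * (real n - 1)) / 2\<rfloor>)"
proof -
  define q where "q = n - 1"
  define M where "M = ex p (T3_vertices n) (T3_edges n)"
  have n: "n = q + 1" "9 \<le> q" and r: "r < q" using assms(1,4) by (auto simp: q_def)
  have p: "p = k * q + r" using assms(5) by (simp add: q_def)
  \<comment> \<open>One of the \<open>k\<close> cliques is set aside, to be merged with the last
    \<open>r\<close> vertices in \<open>low2\<close>.\<close>
  obtain k' where k: "k = Suc k'" using assms(3) by (cases k) auto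
  have low1: "k * q * (q - 1) + r * (r - 1) \<le> 2 * M"
    using ex_ge_cliques[of n r p k] assms r by (simp add: M_def n(1))
  have low2: "k' * q * (q - 1) + (q + r) * (q - 4) \<le> 2 * M + 1"
    using ex_ge_near_regular[of n p k' "q + r"] assms(1) p by (simp add: M_def n(1) k)
  let ?S = "{card E | E. simple_graph {0..<p} E \<and> \<not> contains_subgraph {0..<p} E (T3_vertices n) (T3_edges n)}"
  have "\<not> contains_subgraph {0..<p} {} (T3_vertices n) (T3_edges n)"
    using assms(1) by (simp add: contains_T3_iff)
  then have "?S \<noteq> {}" by (auto simp: simple_graph_def)
  then have "M \<in> ?S" unfolding M_def ex_def by (intro Max_in finite_T3_free_cards)
  then obtain E where E: "M = card E" "simple_graph {0..<p} E"
    "\<not> contains_subgraph {0..<p} E (T3_vertices n) (T3_edges n)" by auto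
  have "2 * M + psi q p \<le> (q - 1) * p"
    using simple_graph_card_le[OF assms(1) E(2,3)] by (simp add: E(1) n(1))
  moreover have "psi q p = min (r * (q - r)) (3 * (q + r))"
  proof -
    have "p mod q = r" using r by (simp add: p)
    moreover have "\<not> p < q" by (simp add: p k)
    ultimately show ?thesis by (simp add: psi_def phi_def)
  qed
  ultimately have up: "2 * M + min (r * (q - r)) (3 * (q + r)) \<le> (q - 1) * p" by simp
  obtain i where i: "q = 9 + i" using n(2) le_Suc_ex by blast
  \<comment> \<open>\<open>A\<close> is twice the size of the clique construction; \<open>t\<close>
    is the signed gain, in doubled edges and before rounding, from replacing one clique and the
    remainder by a graph of degree \<open>q - 4\<close>.\<close>
  define A t where "A = int k * int q * (int q - 1) + int r * (int r - 1)"
    and "t = int r * (int q - 3 - int r) - 3 * int q"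
  have A1: "A \<le> 2 * int M"
  proof -
    have "int (k * q * (q - 1) + r * (r - 1)) = A"
    proof -
      have "int (q - 1) = int q - 1" using n(2) by simp
      moreover have "int r * int (r - 1) = int r * (int r - 1)" by (cases r) auto
      ultimately show ?thesis by (simp only: A_def of_nat_add of_nat_mult)
    qed
    then show ?thesis using low1 by linarith
  qed
  have A2: "A + t \<le> 2 * int M + 1"
  proof -
    have "int (k' * q * (q - 1) + (q + r) * (q - 4)) = A + t"
      by (simp add: A_def t_def k i algebra_simps)
    then show ?thesis using low2 by linarith
  qed
  have A3: "2 * int M \<le> max A (A + t)"
  proof -
    have 1: "int ((q - 1) * p) = A + int r * (int q - int r)"
      by (simp add: A_def p i algebra_simps)
    have 2: "int (r * (q - r)) = int r * (int q - int r)" using r by (simp add: of_nat_diff)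
    \<comment> \<open>By this identity the minimum in \<open>up\<close> is
      \<open>r * (q - r) - max 0 t\<close>, which turns the upper bound into
      \<open>max A (A + t)\<close>.\<close>
    have 3: "int r * (int q - int r) = t + 3 * (int q + int r)" by (simp add: t_def algebra_simps)
    have "int (2 * M + min (r * (q - r)) (3 * (q + r))) \<le> int ((q - 1) * p)"
      using up by (simp only: of_nat_le_iff)
    then have "2 * int M + min (int r * (int q - int r)) (3 * (int q + int r)) \<le> A + int r * (int q - int r)"
      unfolding 1 using r by (simp add: of_nat_min of_nat_diff)
    then show ?thesis using 3 by linarith
  qed
  have "even A" by (simp add: A_def)
  then obtain c where c: "A = 2 * c" by (rule evenE)
  \<comment> \<open>Since \<open>A\<close> is even, \<open>2 * M\<close> cannot attain
    \<open>A + t\<close> for odd \<open>t\<close>; the three bounds then leave exactly the floor of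
    \<open>t / 2\<close>, cut off at 0, as the gain.\<close>
  have M: "int M = c + max 0 (t div 2)" using A1 A2 A3 c by linarith
  have "((real n - 2) * real p - real r * (real n - 1 - real r)) = real_of_int A"
    by (simp add: n(1) p A_def algebra_simps)
  moreover have "\<lfloor>(real r * (real n - 4 - real r) - 3 * (real n - 1)) / 2\<rfloor> = t div 2"
  proof -
    have "real r * (real n - 4 - real r) - 3 * (real n - 1) = real_of_int t"
      by (simp add: n(1) t_def algebra_simps)
    then show ?thesis using floor_divide_of_int_eq[of t 2] by simp
  qed
  moreover have "real M = real_of_int c + real_of_int (max 0 (t div 2))"
    using M by (metis of_int_add of_int_of_nat_eq)
  ultimately show ?thesis unfolding M_def[symmetric] c by simp
qed

end
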